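(* For each $d\in[1,+\infty]$ the formula $$\varphi_{s,t}:=f_s^{-1}\circ f_t,\qquad 0\le s\le t<+\infty,\qquad( * )$$ establishes a 1-to-1 correspondence between decreasing Loewner chains $(f_t)$ of order $d$ and reverse evolution families $(\varphi_{s,t})$ of the same order $d$. Namely, for every decreasing Loewner chain $(f_t)$ of order $d$ the family $(\varphi_{s,t})_{0\le s\le t}$ defined by $( * )$ is a reverse evolution family of order $d$. Conversely, for any reverse evolution family $(\varphi_{s,t})$ of order $d$ the family $(f_t)_{t\ge0}=(\varphi_{0,t})_{t\ge0}$ is a decreasing Loewner chain of order $d$ satisfying equality $( * )$.
   Context: $\mathbb{D}=\{z\in\mathbb{C}:|z|<1\}$. Decreasing Loewner chain of order $d$: a family $(f_t)_{t\ge0}$ of holomorphic self-maps of $\mathbb{D}$ such that (DC1) each $f_t:\mathbb{D}\to\mathbb{D}$ is univalent; (DC2) $f_0=\mathrm{id}_{\mathbb{D}}$ and $f_t(\mathbb{D})\subset f_s(\mathbb{D})$ whenever $0\le s\le t$; (DC3) for any compact set $K\subset\mathbb{D}$ and all $T>0$ there exists a non-negative function $k_{K,T}\in L^d([0,T],\mathbb{R})$ such that $|f_s(z)-f_t(z)|\le\int_s^tk_{K,T}(\xi)\,d\xi$ for all $z\in K$ and all $0\le s\le t\le T$. Reverse evolution family of order $d$: a family $(\varphi_{s,t})_{0\le s\le t}$ of holomorphic self-maps of $\mathbb{D}$ such that (REF1) $\varphi_{s,s}=\mathrm{id}_{\mathbb{D}}$ for all $s\ge0$; (REF2) $\varphi_{s,t}=\varphi_{s,u}\circ\varphi_{u,t}$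 for all $0\le s\le u\le t<+\infty$; (REF3) for any $z\in\mathbb{D}$ and any $T>0$ there exists a non-negative function $k_{z,T}\in L^d([0,T],\mathbb{R})$ such that $|\varphi_{s,u}(z)-\varphi_{s,t}(z)|\le\int_u^tk_{z,T}(\xi)\,d\xi$ for all $s,u,t\in[0,T]$ with $s\le u\le t$. *)

theory Defs
  imports "HOL-Complex_Analysis.Complex_Analysis" "HOL-Probability.Essential_Supremum"
    "HOL-Library.FuncSet"
begin

abbreviation unit_disc :: "complex set"
  where "unit_disc \<equiv> ball 0 1"

definition Lp_fun :: "ennreal \<Rightarrow> real set \<Rightarrow> (real \<Rightarrow> real) set"
  where "Lp_fun d A = {k. k \<in> borel_measurable (lebesgue_on A) \<and>
    (if d = \<infinity> then esssup (lebesgue_on A) (\<lambda>x. ereal \<bar>k x\<bar>) < \<infinity>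
     else integrable (lebesgue_on A) (\<lambda>x. \<bar>k x\<bar> powr enn2real d))}"

definition holomorphic_self_map :: "(complex \<Rightarrow> complex) \<Rightarrow> bool"
  where "holomorphic_self_map g \<longleftrightarrow> g holomorphic_on unit_disc \<and> g ` unit_disc \<subseteq> unit_disc"

text \<open>The two predicates below constrain a family only at parameters \<open>0 \<le> t\<close>, respectively
  \<open>0 \<le> s \<le> t\<close>, and at points of the disc; all other values are irrelevant.\<close>

definition decreasing_Loewner_chain :: "ennreal \<Rightarrow> (real \<Rightarrow> complex \<Rightarrow> complex) \<Rightarrow> bool"
  where "decreasing_Loewner_chain d f \<longleftrightarrow>
    (\<forall>t\<ge>0. holomorphic_self_map (f t)) \<and>
    (\<forall>t\<ge>0. inj_on (f t) unit_disc) \<and>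
    (\<forall>z\<in>unit_disc. f 0 z = z) \<and>
    (\<forall>s t. 0 \<le> s \<and> s \<le> t \<longrightarrow> f t ` unit_disc \<subseteq> f s ` unit_disc) \<and>
    (\<forall>K T. compact K \<and> K \<subseteq> unit_disc \<and> 0 < T \<longrightarrow>
      (\<exists>k\<in>Lp_fun d {0..T}. (\<forall>\<xi>\<in>{0..T}. 0 \<le> k \<xi>) \<and>
        (\<forall>z\<in>K. \<forall>s t. 0 \<le> s \<and> s \<le> t \<and> t \<le> T \<longrightarrow>
          cmod (f s z - f t z) \<le> (LINT \<xi>:{s..t}|lebesgue. k \<xi>))))"

definition reverse_evolution_family :: "ennreal \<Rightarrow> (real \<Rightarrow> real \<Rightarrow> complex \<Rightarrow> complex) \<Rightarrow> bool"
  where "reverse_evolution_family d \<phi> \<longleftrightarrow>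
    (\<forall>s t. 0 \<le> s \<and> s \<le> t \<longrightarrow> holomorphic_self_map (\<phi> s t)) \<and>
    (\<forall>s\<ge>0. \<forall>z\<in>unit_disc. \<phi> s s z = z) \<and>
    (\<forall>s u t. 0 \<le> s \<and> s \<le> u \<and> u \<le> t \<longrightarrow> (\<forall>z\<in>unit_disc. \<phi> s t z = \<phi> s u (\<phi> u t z))) \<and>
    (\<forall>z\<in>unit_disc. \<forall>T>0.
      (\<exists>k\<in>Lp_fun d {0..T}. (\<forall>\<xi>\<in>{0..T}. 0 \<le> k \<xi>) \<and>
        (\<forall>s u t. 0 \<le> s \<and> s \<le> u \<and> u \<le> t \<and> t \<le> T \<longrightarrow>
          cmod (\<phi> s u z - \<phi> s t z) \<le> (LINT \<xi>:{u..t}|lebesgue. k \<xi>))))"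

text \<open>The family \<open>f\<^sub>s\<^sup>-\<^sup>1 \<circ> f\<^sub>t\<close>, set to \<open>undefined\<close> off its domain, where \<open>f\<^sub>s\<^sup>-\<^sup>1\<close> is the inverse of
  \<open>f\<^sub>s\<close> as a bijection of the disc onto its image.\<close>

definition transition_maps ::
  "(real \<Rightarrow> complex \<Rightarrow> complex) \<Rightarrow> real \<Rightarrow> real \<Rightarrow> complex \<Rightarrow> complex"
  where "transition_maps f = (\<lambda>s t. if 0 \<le> s \<and> s \<le> t
    then compose unit_disc (the_inv_into unit_disc (f s)) (f t) else undefined)"

text \<open>Families as mathematical objects: one extensional representative (\<open>undefined\<close> off the domain)
  for each, so that equality of families is equality in HOL.\<close>

definition decreasing_Loewner_chains :: "ennreal \<Rightarrow> (real \<Rightarrow> complex \<Rightarrow> complex) set"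
  where "decreasing_Loewner_chains d = {f. decreasing_Loewner_chain d f \<and>
    (\<forall>t\<ge>0. f t \<in> extensional unit_disc) \<and> (\<forall>t. \<not> 0 \<le> t \<longrightarrow> f t = undefined)}"

definition reverse_evolution_families :: "ennreal \<Rightarrow> (real \<Rightarrow> real \<Rightarrow> complex \<Rightarrow> complex) set"
  where "reverse_evolution_families d = {\<phi>. reverse_evolution_family d \<phi> \<and>
    (\<forall>s t. 0 \<le> s \<and> s \<le> t \<longrightarrow> \<phi> s t \<in> extensional unit_disc) \<and>
    (\<forall>s t. \<not> (0 \<le> s \<and> s \<le> t) \<longrightarrow> \<phi> s t = undefined)}"

end

theory Submission
  imports Defs
begin

text \<open>
  The algebra of the correspondence is immediate: \<open>f\<^sub>s \<circ> \<phi>\<^sub>s\<^sub>,\<^sub>t = f\<^sub>t\<close> turns the inclusion of the images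
  into the semigroup law and back, and \<open>f\<^sub>0 = id\<close> recovers \<open>f\<^sub>t\<close> as \<open>\<phi>\<^sub>0\<^sub>,\<^sub>t\<close>. The content is
  analytic: each side satisfies an \<open>L\<^sup>d\<close> estimate that has to be carried over to the other, and the
  maps of a reverse evolution family have to be shown univalent.

  From a chain to a family. Since \<open>f\<^sub>u(z) - f\<^sub>t(z)\<close> is the difference of the values of \<open>f\<^sub>s\<close> at
  \<open>\<phi>\<^sub>s\<^sub>,\<^sub>u(z)\<close> and \<open>\<phi>\<^sub>s\<^sub>,\<^sub>t(z)\<close>, the kernel of the chain serves for the family up to a factor, provided
  that \<open>f\<^sub>s\<close> expands distances by at least a fixed factor on a compact set that contains all these
  points. A single univalent function has a positive lower Lipschitz constant on each smaller disc
  (\<open>univalent_lower_Lipschitz\<close>). The constant persists under small perturbations, and the chain is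
  uniformly continuous in time, so that compactness of \<open>[0,T]\<close> gives one constant for all \<open>s\<close>
  (\<open>chain_lower_Lipschitz\<close>). The same constant bounds from below the size of the disc around
  \<open>f\<^sub>s(w)\<close> covered by \<open>f\<^sub>s\<close>, which makes \<open>\<phi>\<^sub>s\<^sub>,\<^sub>u(z)\<close> locally bounded away from the unit circle in
  \<open>(s,u)\<close>; compactness of the triangle \<open>0 \<le> s \<le> u \<le> T\<close> finishes the argument
  (\<open>transition_orbit_compact\<close>).

  From a family to a chain. The hypothesis bounds \<open>z - \<phi>\<^sub>s\<^sub>,\<^sub>t(z)\<close> for one \<open>z\<close> at a time, with a kernel
  that depends on \<open>z\<close>. Uniformity comes from a rigidity property of self-maps: on a smaller disc the
  displacement \<open>z - g(z)\<close> of any self-map \<open>g\<close> is dominated by its displacements at the two points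
  \<open>0\<close> and \<open>1/2\<close> (\<open>self_map_displacement\<close>, a consequence of the Schwarz lemma and of Harnack's
  inequality). Hence a multiple of the sum of two kernels serves that whole disc, and \<open>\<phi>\<^sub>s\<^sub>,\<^sub>t\<close> is uniformly close to the
  identity there when \<open>t - s\<close> is small. Composing short steps, each of which moves points towards the
  circle by a controlled amount only, keeps the orbits of a compact set in a compact set
  (\<open>family_locally_bounded\<close>); on it each short step is injective, and so is the composition
  (\<open>family_univalent\<close>). The estimate for the chain then follows by applying the Lipschitz bound of
  \<open>\<phi>\<^sub>0\<^sub>,\<^sub>s\<close> to the points \<open>z\<close> and \<open>\<phi>\<^sub>s\<^sub>,\<^sub>t(z)\<close>.
\<close>

section \<open>Kernels of class $L^d$\<close>

lemma Lp_fun_infinity_iff: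
  assumes "d = \<infinity>"
  shows "k \<in> Lp_fun d A \<longleftrightarrow>
    k \<in> borel_measurable (lebesgue_on A) \<and> (\<exists>B. AE x in lebesgue_on A. \<bar>k x\<bar> \<le> B)"
proof (cases "k \<in> borel_measurable (lebesgue_on A)")
  case True
  let ?M = "lebesgue_on A" and ?e = "esssup (lebesgue_on A) (\<lambda>x. ereal \<bar>k x\<bar>)"
  have meas: "(\<lambda>x. ereal \<bar>k x\<bar>) \<in> borel_measurable ?M"
    using True by measurable
  have "?e < \<infinity> \<longleftrightarrow> (\<exists>B. AE x in ?M. \<bar>k x\<bar> \<le> B)"
  proof
    assume "?e < \<infinity>"
    then obtain B :: real where B: "?e \<le> ereal B"
      by (cases ?e) auto
    have "AE x in ?M. ereal \<bar>k x\<bar> \<le> ereal B"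
      using esssup_AE[where M = ?M and f = "\<lambda>x. ereal \<bar>k x\<bar>"]
      by (rule eventually_mono) (use B order_trans in blast)
    then show "\<exists>B. AE x in ?M. \<bar>k x\<bar> \<le> B" by auto
  next
    assume "\<exists>B. AE x in ?M. \<bar>k x\<bar> \<le> B"
    then obtain B where "AE x in ?M. ereal \<bar>k x\<bar> \<le> ereal B" by auto
    from esssup_I[OF meas this] show "?e < \<infinity>"
      by (rule le_less_trans) simp
  qed
  with True assms show ?thesis by (simp add: Lp_fun_def)
qed (simp add: Lp_fun_def)

lemma Lp_fun_finite_iff:
  "d \<noteq> \<infinity> \<Longrightarrow> k \<in> Lp_fun d A \<longleftrightarrow>
    k \<in> borel_measurable (lebesgue_on A) \<and>
    integrable (lebesgue_on A) (\<lambda>x. \<bar>k x\<bar> powr enn2real d)"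
  by (simp add: Lp_fun_def)

lemma Lp_fun_cmult:
  assumes "k \<in> Lp_fun d A"
  shows "(\<lambda>x. c * k x) \<in> Lp_fun d A"
proof (cases "d = \<infinity>")
  case True
  with assms obtain B where k: "k \<in> borel_measurable (lebesgue_on A)"
    and B: "AE x in lebesgue_on A. \<bar>k x\<bar> \<le> B"
    unfolding Lp_fun_infinity_iff[OF True] by blast
  from B have "AE x in lebesgue_on A. \<bar>c * k x\<bar> \<le> \<bar>c\<bar> * B"
    by (rule eventually_mono) (simp add: abs_mult mult_left_mono)
  with k show ?thesis unfolding Lp_fun_infinity_iff[OF True] by auto
next
  case False
  with assms show ?thesis
    by (auto simp: Lp_fun_finite_iff abs_mult powr_mult)
qed

lemma Lp_fun_add:
  assumes "k \<in> Lp_fun d A" "l \<in> Lp_fun d A"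
  shows "(\<lambda>x. k x + l x) \<in> Lp_fun d A"
proof (cases "d = \<infinity>")
  case True
  with assms obtain B C where k: "k \<in> borel_measurable (lebesgue_on A)"
    and l: "l \<in> borel_measurable (lebesgue_on A)"
    and B: "AE x in lebesgue_on A. \<bar>k x\<bar> \<le> B" and C: "AE x in lebesgue_on A. \<bar>l x\<bar> \<le> C"
    unfolding Lp_fun_infinity_iff[OF True] by blast
  from AE_conjI[OF B C] have "AE x in lebesgue_on A. \<bar>k x + l x\<bar> \<le> B + C"
    by (rule eventually_mono) auto
  with k l show ?thesis unfolding Lp_fun_infinity_iff[OF True] by auto
next
  case False
  let ?p = "enn2real d"
  from assms False have k: "k \<in> borel_measurable (lebesgue_on A)"
    and l: "l \<in> borel_measurable (lebesgue_on A)"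
    and ik: "integrable (lebesgue_on A) (\<lambda>x. \<bar>k x\<bar> powr ?p)"
    and il: "integrable (lebesgue_on A) (\<lambda>x. \<bar>l x\<bar> powr ?p)"
    by (auto simp: Lp_fun_finite_iff)
  have bound: "\<bar>k x + l x\<bar> powr ?p \<le> 2 powr ?p * (\<bar>k x\<bar> powr ?p + \<bar>l x\<bar> powr ?p)" for x
  proof -
    have "\<bar>k x + l x\<bar> powr ?p \<le> (2 * max \<bar>k x\<bar> \<bar>l x\<bar>) powr ?p"
      by (rule powr_mono2) auto
    also have "\<dots> = 2 powr ?p * max \<bar>k x\<bar> \<bar>l x\<bar> powr ?p"
      by (simp add: powr_mult)
    also have "\<dots> \<le> 2 powr ?p * (\<bar>k x\<bar> powr ?p + \<bar>l x\<bar> powr ?p)"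
      by (intro mult_left_mono) (auto simp: max_def)
    finally show ?thesis .
  qed
  have "integrable (lebesgue_on A) (\<lambda>x. 2 powr ?p * (\<bar>k x\<bar> powr ?p + \<bar>l x\<bar> powr ?p))"
    using ik il by simp
  then have "integrable (lebesgue_on A) (\<lambda>x. \<bar>k x + l x\<bar> powr ?p)"
    by (rule Bochner_Integration.integrable_bound) (use k l bound in auto)
  with k l False show ?thesis by (simp add: Lp_fun_finite_iff)
qed

text \<open>On a set of finite measure \<open>L\<^sup>d\<close> embeds in \<open>L\<^sup>1\<close>; for finite \<open>d\<close> because
  \<open>\<bar>k\<bar> \<le> 1 + \<bar>k\<bar>\<^sup>d\<close>. Without this the integrals of a kernel over subintervals would carry no
  information, since the Bochner integral of a non-integrable function is \<open>0\<close>.\<close>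

lemma Lp_fun_integrable:
  assumes d: "1 \<le> d" and A: "A \<in> lmeasurable" and k: "k \<in> Lp_fun d A"
  shows "integrable (lebesgue_on A) k"
proof -
  interpret finite_measure "lebesgue_on A"
    using A by (rule finite_measure_lebesgue_on)
  show ?thesis
  proof (cases "d = \<infinity>")
    case True
    with k obtain B where "k \<in> borel_measurable (lebesgue_on A)"
      "AE x in lebesgue_on A. \<bar>k x\<bar> \<le> B"
      unfolding Lp_fun_infinity_iff[OF True] by blast
    then show ?thesis by (intro integrable_const_bound[of _ B]) auto
  next
    case False
    have p: "1 \<le> enn2real d"
      using d False enn2real_mono[of 1 d] by (simp add: top.not_eq_extremum)
    have "\<bar>k x\<bar> \<le> 1 + \<bar>k x\<bar> powr enn2real d" for x
    proof (cases "\<bar>k x\<bar> \<le> 1")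
      case False
      then show ?thesis using powr_mono[OF p, of "\<bar>k x\<bar>"] by simp
    qed (simp add: add_increasing2)
    moreover have "integrable (lebesgue_on A) (\<lambda>x. 1 + \<bar>k x\<bar> powr enn2real d)"
      using k False by (simp add: Lp_fun_finite_iff)
    ultimately show ?thesis
      using k False by (intro Bochner_Integration.integrable_bound[of _ "\<lambda>x. 1 + \<bar>k x\<bar> powr enn2real d" k])
        (auto simp: Lp_fun_finite_iff)
  qed
qed

lemma Lp_fun_set_integrable:
  assumes d: "1 \<le> d" and k: "k \<in> Lp_fun d {0..T}" and st: "0 \<le> s" "t \<le> T"
  shows "set_integrable lebesgue {s..t} k"
proof -
  have "integrable (lebesgue_on {0..T}) k"
    by (rule Lp_fun_integrable[OF d _ k]) simp
  then have "set_integrable lebesgue {0..T} k"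
    by (simp add: set_integrable_def integrable_restrict_space)
  then show ?thesis
    by (rule set_integrable_subset) (use st in auto)
qed

text \<open>Absolute continuity of the indefinite integral. Through it the integral conditions on chains and
  on families give uniform continuity in time.\<close>

lemma Lp_fun_small_integrals:
  assumes d: "1 \<le> d" and k: "k \<in> Lp_fun d {0..T}" and e: "0 < e"
  obtains \<delta> where "0 < \<delta>"
    "\<And>s t. 0 \<le> s \<Longrightarrow> s \<le> t \<Longrightarrow> t \<le> T \<Longrightarrow> t - s < \<delta> \<Longrightarrow> (LINT \<xi>:{s..t}|lebesgue. k \<xi>) < e"
proof -
  have int: "k integrable_on {s..t}" "(LINT \<xi>:{s..t}|lebesgue. k \<xi>) = integral {s..t} k"
    if "0 \<le> s" "t \<le> T" for s t
    using set_lebesgue_integral_eq_integral[OF Lp_fun_set_integrable[OF d k that]] by auto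
  have "uniformly_continuous_on {0..T} (\<lambda>t. integral {0..t} k)"
    using int(1)[of 0 T]
    by (intro compact_uniformly_continuous indefinite_integral_continuous_1) auto
  then obtain \<delta> where \<delta>: "0 < \<delta>" and close:
    "\<And>s t. s \<in> {0..T} \<Longrightarrow> t \<in> {0..T} \<Longrightarrow> dist t s < \<delta> \<Longrightarrow>
      dist (integral {0..t} k) (integral {0..s} k) < e"
    using e unfolding uniformly_continuous_on_def by metis
  show ?thesis
  proof (rule that[OF \<delta>])
    fix s t assume st: "0 \<le> s" "s \<le> t" "t \<le> T" "t - s < \<delta>"
    have "integral {0..s} k + integral {s..t} k = integral {0..t} k"
      using st int(1)[of 0 t] by (intro Henstock_Kurzweil_Integration.integral_combine) auto
    moreover have "dist (integral {0..t} k) (integral {0..s} k) < e"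
      using st by (intro close) (auto simp: dist_real_def)
    ultimately show "(LINT \<xi>:{s..t}|lebesgue. k \<xi>) < e"
      using int(2)[of s t] st by (simp add: dist_real_def)
  qed
qed

section \<open>Harnack's inequality and self-maps of the disc\<close>

text \<open>The Cayley transform \<open>u = (q - q(0)) / (q + cnj q(0))\<close> maps the right half-plane to the disc and
  \<open>q(0)\<close> to \<open>0\<close>, so the Schwarz lemma gives \<open>\<bar>u(z)\<bar> \<le> \<bar>z\<bar>\<close>. Solving for \<open>q\<close> yields
  \<open>q(0) + u cnj q(0) = q (1 - u)\<close>, whose two sides are comparable to \<open>q(0)\<close> and to \<open>q\<close>.\<close>

lemma Harnack_positive:
  assumes q: "q holomorphic_on unit_disc" and pos: "\<And>z. z \<in> unit_disc \<Longrightarrow> 0 < Re (q z)"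
    and z: "z \<in> unit_disc"
  shows "cmod (q z) * (1 - cmod z) \<le> cmod (q 0) * (1 + cmod z)"
    and "cmod (q 0) * (1 - cmod z) \<le> cmod (q z) * (1 + cmod z)"
proof -
  define u where "u = (\<lambda>w. (q w - q 0) / (q w + cnj (q 0)))"
  have den: "q w + cnj (q 0) \<noteq> 0" if "w \<in> unit_disc" for w
    using pos[OF that] pos[of 0] by (auto simp: complex_eq_iff)
  have "u holomorphic_on unit_disc"
    unfolding u_def using den by (intro holomorphic_intros q) auto
  moreover have "u 0 = 0" by (simp add: u_def)
  moreover have "cmod (u w) < 1" if "cmod w < 1" for w
  proof -
    have w: "w \<in> unit_disc" using that by simp
    have "0 < Re (q w) * Re (q 0)" using pos[OF w] pos[of 0] by simp
    then have "(cmod (q w - q 0))\<^sup>2 < (cmod (q w + cnj (q 0)))\<^sup>2"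
      unfolding cmod_power2 by (simp add: power2_eq_square algebra_simps)
    then have "cmod (q w - q 0) < cmod (q w + cnj (q 0))"
      by (rule power2_less_imp_less) simp
    then show ?thesis using den[OF w] by (simp add: u_def norm_divide)
  qed
  ultimately have u_le: "cmod (u z) \<le> cmod z"
    using z by (intro Schwarz_Lemma(1)) auto
  have eq: "q 0 + u z * cnj (q 0) = q z * (1 - u z)"
    using den[OF z] by (simp add: u_def field_simps)
  have lower: "cmod a * (1 - cmod z) \<le> cmod (a + b)"
    and upper: "cmod (a + b) \<le> cmod a * (1 + cmod z)"
    if "cmod b = cmod (u z) * cmod a" for a b :: complex
    using that mult_right_mono[OF u_le, of "cmod a"] norm_diff_ineq[of a b] norm_triangle_ineq[of a b]
    by (auto simp: algebra_simps)
  have *: "cmod (u z * cnj (q 0)) = cmod (u z) * cmod (q 0)"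
    "cmod (- (q z * u z)) = cmod (u z) * cmod (q z)"
    by (simp_all add: norm_mult)
  have eq': "q z * (1 - u z) = q z + - (q z * u z)" by (simp add: algebra_simps)
  show "cmod (q z) * (1 - cmod z) \<le> cmod (q 0) * (1 + cmod z)"
    using lower[OF *(2)] upper[OF *(1)] unfolding eq eq' by linarith
  show "cmod (q 0) * (1 - cmod z) \<le> cmod (q z) * (1 + cmod z)"
    using lower[OF *(1)] upper[OF *(2)] unfolding eq eq' by linarith
qed

text \<open>The nonnegative case follows by adding a positive constant to \<open>q\<close> and letting it tend to \<open>0\<close>.
  In the applications \<open>q = 1 - p\<close> with \<open>\<bar>p\<bar> \<le> 1\<close>, and \<open>p\<close> may be the constant \<open>1\<close>.\<close>

lemma Harnack:
  assumes q: "q holomorphic_on unit_disc" and pos: "\<And>z. z \<in> unit_disc \<Longrightarrow> 0 \<le> Re (q z)"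
    and z: "z \<in> unit_disc"
  shows "cmod (q z) * (1 - cmod z) \<le> cmod (q 0) * (1 + cmod z)"
    and "cmod (q 0) * (1 - cmod z) \<le> cmod (q z) * (1 + cmod z)"
proof -
  have z1: "cmod z < 1" using z by simp
  have close: "cmod w \<le> cmod (w + of_real e) + e" "cmod (w + of_real e) \<le> cmod w + e"
    if "0 < e" for w :: complex and e
    using that norm_triangle_ineq4[of "w + of_real e" "of_real e"] norm_triangle_ineq[of w "of_real e"]
    by auto
  have pass: "a * (1 - cmod z) \<le> b * (1 + cmod z)"
    if "\<And>e. 0 < e \<Longrightarrow> (a - e) * (1 - cmod z) \<le> (b + e) * (1 + cmod z)" for a b
  proof (rule field_le_epsilon)
    fix e :: real assume "0 < e"
    with that[of "e/2"] show "a * (1 - cmod z) \<le> b * (1 + cmod z) + e"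
      by (simp add: field_simps)
  qed
  have strict:
    "cmod (q z + of_real e) * (1 - cmod z) \<le> cmod (q 0 + of_real e) * (1 + cmod z)"
    "cmod (q 0 + of_real e) * (1 - cmod z) \<le> cmod (q z + of_real e) * (1 + cmod z)"
    if "0 < e" for e
  proof -
    have "(\<lambda>w. q w + of_real e) holomorphic_on unit_disc"
      by (intro holomorphic_intros q)
    moreover have "0 < Re (q w + of_real e)" if "w \<in> unit_disc" for w
      using pos[OF that] \<open>0 < e\<close> by simp
    ultimately show
      "cmod (q z + of_real e) * (1 - cmod z) \<le> cmod (q 0 + of_real e) * (1 + cmod z)"
      "cmod (q 0 + of_real e) * (1 - cmod z) \<le> cmod (q z + of_real e) * (1 + cmod z)"
      using Harnack_positive[of "\<lambda>w. q w + of_real e" z] z by blast+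
  qed
  have push: "(cmod v - e) * (1 - cmod z) \<le> (cmod w + e) * (1 + cmod z)"
    if "0 < e" "cmod (v + of_real e) * (1 - cmod z) \<le> cmod (w + of_real e) * (1 + cmod z)"
    for v w :: complex and e
  proof -
    have "(cmod v - e) * (1 - cmod z) \<le> cmod (v + of_real e) * (1 - cmod z)"
      using close(1)[OF that(1), of v] z1 by (intro mult_right_mono) auto
    also have "\<dots> \<le> cmod (w + of_real e) * (1 + cmod z)" by (rule that(2))
    also have "\<dots> \<le> (cmod w + e) * (1 + cmod z)"
      using close(2)[OF that(1), of w] by (intro mult_right_mono) auto
    finally show ?thesis .
  qed
  show "cmod (q z) * (1 - cmod z) \<le> cmod (q 0) * (1 + cmod z)"
    by (rule pass, rule push, assumption, rule strict(1))
  show "cmod (q 0) * (1 - cmod z) \<le> cmod (q z) * (1 + cmod z)"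
    by (rule pass, rule push, assumption, rule strict(2))
qed

lemma holomorphic_self_mapD:
  assumes "holomorphic_self_map g"
  shows "g holomorphic_on unit_disc" and "z \<in> unit_disc \<Longrightarrow> g z \<in> unit_disc"
    and "cmod z < 1 \<Longrightarrow> cmod (g z) < 1"
  using assms image_subset_iff[of g unit_disc unit_disc] by (auto simp: holomorphic_self_map_def)

text \<open>Harnack's inequality for \<open>1 - c g\<close>, where the unimodular \<open>c\<close> rotates \<open>g(w)\<close> to the positive
  real axis. The bound is multiplicative in the distances to the unit circle, so that it can be
  iterated along a composition of self-maps.\<close>

lemma self_map_boundary_distance:
  assumes g: "holomorphic_self_map g" and w: "w \<in> unit_disc"
  shows "(1 - cmod (g 0)) * (1 - cmod w) / 2 \<le> 1 - cmod (g w)"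
proof (cases "g w = 0")
  case True
  have "(1 - cmod (g 0)) * (1 - cmod w) \<le> 1 * 1"
    using w by (intro mult_mono) auto
  with True show ?thesis by simp
next
  case False
  define c where "c = cnj (g w) / cmod (g w)"
  have c: "cmod c = 1" "c * g w = cmod (g w)"
    using False by (auto simp: c_def norm_divide mult.commute[of "cnj _"] complex_norm_square[symmetric]
        power2_eq_square)
  define q where "q = (\<lambda>z. 1 - c * g z)"
  have q: "q holomorphic_on unit_disc"
    unfolding q_def by (intro holomorphic_intros holomorphic_self_mapD(1)[OF g])
  have im: "cmod (g z) < 1" if "z \<in> unit_disc" for z
    using holomorphic_self_mapD(2)[OF g that] by simp
  have le: "cmod (c * g z) < 1" if "z \<in> unit_disc" for z
    using im[OF that] c by (simp add: norm_mult)
  have "0 \<le> Re (q z)" if "z \<in> unit_disc" for z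
    using le[OF that] complex_Re_le_cmod[of "c * g z"] by (simp add: q_def)
  from Harnack(2)[OF q this w] have H: "cmod (q 0) * (1 - cmod w) \<le> cmod (q w) * (1 + cmod w)" .
  have "q w = of_real (1 - cmod (g w))"
    using c by (simp add: q_def)
  then have qw: "cmod (q w) = 1 - cmod (g w)"
    using im[OF w] by (simp only: norm_of_real)
  have "1 - cmod (g 0) \<le> cmod (q 0)"
    using norm_triangle_ineq2[of 1 "c * g 0"] c by (simp add: q_def norm_mult)
  then have "(1 - cmod (g 0)) * (1 - cmod w) \<le> cmod (q 0) * (1 - cmod w)"
    using w by (intro mult_right_mono) auto
  also note H
  also have "cmod (q w) * (1 + cmod w) \<le> (1 - cmod (g w)) * 2"
    using w im[OF w] unfolding qw by (intro mult_left_mono) auto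
  finally show ?thesis by simp
qed

text \<open>Write \<open>g(z) = a + (1 + \<bar>a\<bar>) z p(z)\<close> with \<open>a = g(0)\<close>. By the Schwarz lemma \<open>\<bar>p\<bar> \<le> 1\<close>, so that
  \<open>1 - p\<close> has nonnegative real part and Harnack's inequality compares its values at \<open>z\<close> and at
  \<open>1/2\<close>. Up to terms of size \<open>\<bar>a\<bar>\<close>, the displacement of \<open>g\<close> at \<open>z\<close> is \<open>z (1 - p(z))\<close>. The point
  \<open>1/2\<close> may be replaced by any other point of the disc except \<open>0\<close>, where this product vanishes.\<close>

lemma self_map_displacement:
  assumes r: "0 \<le> r" "r < 1"
  obtains C where "0 < C"
    "\<And>g z. holomorphic_self_map g \<Longrightarrow> cmod z \<le> r \<Longrightarrow>
      cmod (z - g z) \<le> C * (cmod (0 - g 0) + cmod (1/2 - g (1/2)))"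
proof -
  define H where "H = 3 * (1 + r) / (1 - r)"
  have H: "0 < H" using r by (simp add: H_def)
  show ?thesis
  proof (rule that[of "4 * H + 2"])
    show "0 < 4 * H + 2" using H by simp
  next
    fix g z assume g: "holomorphic_self_map g" and z: "cmod z \<le> r"
    define a where "a = g 0"
    have hol: "g holomorphic_on unit_disc" and im: "\<And>w. cmod w < 1 \<Longrightarrow> cmod (g w) < 1"
      using holomorphic_self_mapD[OF g] by auto
    \<comment> \<open>The range of \<open>g - a\<close> lies in the disc of radius \<open>1 + \<bar>a\<bar>\<close>.\<close>
    define b where "b = complex_of_real (1 + cmod a)"
    have cb: "cmod b = 1 + cmod a" unfolding b_def by (simp only: norm_of_real) simp
    have "0 < cmod b" unfolding cb by (rule add_pos_nonneg) simp_all
    then have b0: "b \<noteq> 0" by simp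
    define h where "h = (\<lambda>w. (g w - a) / b)"
    have h: "h holomorphic_on unit_disc" "h 0 = 0"
      unfolding h_def using b0 by (auto intro!: holomorphic_intros hol simp: a_def)
    have h1: "cmod (h w) < 1" if "cmod w < 1" for w
    proof -
      have "cmod (g w - a) < 1 + cmod a"
        using im[OF that] norm_triangle_ineq4[of "g w" a] by linarith
      moreover have "0 < 1 + cmod a" by (rule add_pos_nonneg) simp_all
      ultimately show ?thesis
        unfolding h_def norm_divide cb by (simp only: pos_divide_less_eq mult_1_left)
    qed
    obtain p where p: "p holomorphic_on unit_disc" and hp: "\<And>w. cmod w < 1 \<Longrightarrow> h w = w * p w"
      and p0: "deriv h 0 = p 0"
    proof (rule Schwarz3[OF h])
      fix p assume "p holomorphic_on unit_disc" "\<And>w. cmod w < 1 \<Longrightarrow> h w = w * p w" "deriv h 0 = p 0"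
      then show thesis by (rule that)
    qed
    have p1: "cmod (p w) \<le> 1" if "w \<in> unit_disc" for w
    proof (cases "w = 0")
      case True
      with Schwarz_Lemma(2)[OF h h1, of 0] p0 show ?thesis by simp
    next
      case False
      have "cmod w * cmod (p w) \<le> cmod w * 1"
        using Schwarz_Lemma(1)[OF h h1, of w] that hp[of w] by (simp add: norm_mult)
      then show ?thesis using False by (simp add: mult_le_cancel_left)
    qed
    have gp: "w - g w = w * (1 - p w) - (a + of_real (cmod a) * (w * p w))" if "cmod w < 1" for w
    proof -
      have "g w = a + b * (w * p w)"
        using hp[OF that] b0 by (simp add: h_def field_simps)
      then show ?thesis by (simp add: b_def algebra_simps)
    qed
    have small: "cmod (a + of_real (cmod a) * (w * p w)) \<le> 2 * cmod a" if "cmod w < 1" for w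
    proof -
      have "cmod (of_real (cmod a) * (w * p w)) \<le> cmod a * (1 * 1)"
        unfolding norm_mult using that p1[of w] by (intro mult_mono) auto
      then show ?thesis using norm_triangle_ineq[of a "of_real (cmod a) * (w * p w)"] by linarith
    qed
    define q where "q = (\<lambda>w. 1 - p w)"
    have q: "q holomorphic_on unit_disc" unfolding q_def by (intro holomorphic_intros p)
    have pos: "0 \<le> Re (q w)" if "w \<in> unit_disc" for w
      using p1[OF that] complex_Re_le_cmod[of "p w"] by (simp add: q_def)
    have z1: "cmod z < 1" using z r by simp
    have "cmod (q 0) * (1 - 1/2) \<le> cmod (q (1/2)) * (1 + 1/2)"
      using Harnack(2)[OF q pos, of "1/2"] by simp
    then have q0: "cmod (q 0) \<le> 3 * cmod (q (1/2))" by simp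
    have "cmod (q z) * (1 - r) \<le> cmod (q z) * (1 - cmod z)"
      using z by (intro mult_left_mono) auto
    also have "\<dots> \<le> cmod (q 0) * (1 + cmod z)"
      using Harnack(1)[OF q pos, of z] z1 by simp
    also have "\<dots> \<le> (3 * cmod (q (1/2))) * (1 + r)"
      using q0 z by (intro mult_mono) auto
    finally have "cmod (q z) \<le> 3 * cmod (q (1/2)) * (1 + r) / (1 - r)"
      using r by (simp add: pos_le_divide_eq)
    then have qz: "cmod (q z) \<le> H * cmod (q (1/2))"
      by (simp add: H_def algebra_simps)
    have half: "cmod (q (1/2)) \<le> 2 * cmod (1/2 - g (1/2)) + 4 * cmod a"
    proof -
      have eq: "(1/2) * q (1/2) = (1/2 - g (1/2)) + (a + of_real (cmod a) * (1/2 * p (1/2)))"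
        using gp[of "1/2"] by (simp add: q_def)
      have "cmod ((1/2) * q (1/2)) \<le> cmod (1/2 - g (1/2)) + cmod (a + of_real (cmod a) * (1/2 * p (1/2)))"
        unfolding eq by (rule norm_triangle_ineq)
      also have "\<dots> \<le> cmod (1/2 - g (1/2)) + 2 * cmod a"
        by (intro add_left_mono small) simp
      finally have "cmod ((1/2) * q (1/2)) \<le> cmod (1/2 - g (1/2)) + 2 * cmod a" .
      then show ?thesis by (simp add: norm_mult)
    qed
    have "cmod (z - g z) \<le> cmod (z * q z) + cmod (a + of_real (cmod a) * (z * p z))"
      unfolding gp[OF z1] q_def by (rule norm_triangle_ineq4)
    also have "\<dots> \<le> 1 * cmod (q z) + 2 * cmod a"
      unfolding norm_mult[of z] using z1 by (intro add_mono mult_right_mono small) auto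
    also have "\<dots> \<le> H * (2 * cmod (1/2 - g (1/2)) + 4 * cmod a) + 2 * cmod a"
      using qz mult_left_mono[OF half, of H] H by linarith
    also have "\<dots> \<le> (4 * H + 2) * (cmod a + cmod (1/2 - g (1/2)))"
      using H by (simp add: algebra_simps)
    finally show "cmod (z - g z) \<le> (4 * H + 2) * (cmod (0 - g 0) + cmod (1/2 - g (1/2)))"
      by (simp add: a_def)
  qed
qed

text \<open>Cauchy's estimate for the derivative. With \<open>h\<close> the difference of two holomorphic functions, this
  turns uniform closeness into closeness of difference quotients.\<close>

lemma holomorphic_Lipschitz_from_bound:
  assumes h: "h holomorphic_on unit_disc" and R: "R < 1" "r < R"
    and e: "\<And>z. cmod z \<le> R \<Longrightarrow> cmod (h z) \<le> e"
    and ab: "cmod a \<le> r" "cmod b \<le> r"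
  shows "cmod (h a - h b) \<le> e / (R - r) * cmod (a - b)"
proof (rule field_differentiable_bound[of "cball 0 r"])
  fix z :: complex assume z: "z \<in> cball 0 r"
  then have sub: "cball z (R - r) \<subseteq> cball 0 R"
  proof -
    have "cmod x \<le> R" if "cmod (x - z) \<le> R - r" for x
      using that z norm_triangle_sub[of x z] by simp
    then show ?thesis by (auto simp: dist_norm norm_minus_commute)
  qed
  then have sub': "cball z (R - r) \<subseteq> unit_disc" using R by force
  show "(h has_field_derivative deriv h z) (at z within cball 0 r)"
    using z R by (intro DERIV_subset[OF holomorphic_derivI[OF h]]) auto
  have "cmod ((deriv ^^ 1) h z) \<le> fact 1 * e / (R - r) ^ 1"
  proof (rule Cauchy_inequality)
    show "h holomorphic_on ball z (R - r)"
      using holomorphic_on_subset[OF h] sub' ball_subset_cball by blast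
    show "continuous_on (cball z (R - r)) h"
      using holomorphic_on_imp_continuous_on[OF holomorphic_on_subset[OF h sub']] .
    fix x assume "cmod (z - x) = R - r"
    then have "x \<in> cball z (R - r)" by (simp add: dist_norm)
    with sub show "cmod (h x) \<le> e" by (intro e) auto
  qed (use R in auto)
  then show "cmod (deriv h z) \<le> e / (R - r)" by simp
qed (use ab in auto)

lemma self_map_Lipschitz:
  assumes g: "holomorphic_self_map g" and r: "r < 1" and ab: "cmod a \<le> r" "cmod b \<le> r"
  shows "cmod (g a - g b) \<le> 2 / (1 - r) * cmod (a - b)"
proof -
  have "cmod (g a - g b) \<le> 1 / ((1 + r) / 2 - r) * cmod (a - b)"
    by (rule holomorphic_Lipschitz_from_bound[OF holomorphic_self_mapD(1)[OF g]])
       (use r ab holomorphic_self_mapD(3)[OF g] in \<open>auto intro: less_imp_le\<close>)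
  also have "1 / ((1 + r) / 2 - r) = 2 / (1 - r)" using r by (simp add: field_simps)
  finally show ?thesis .
qed

section \<open>Quantitative univalence\<close>

text \<open>The covering argument by which local constants are made uniform. It is used for lower Lipschitz
  constants (over pairs of points and over times) and for the distance of an orbit to the
  unit circle.\<close>

lemma compact_uniform_constant:
  fixes S :: "'a::metric_space set" and P :: "'a \<Rightarrow> real \<Rightarrow> bool"
  assumes S: "compact S"
    and loc: "\<And>x. x \<in> S \<Longrightarrow> \<exists>e>0. \<exists>c>0. \<forall>y\<in>S. dist x y < e \<longrightarrow> P y c"
    and mono: "\<And>y c c'. P y c \<Longrightarrow> 0 < c' \<Longrightarrow> c' \<le> c \<Longrightarrow> P y c'"
  obtains c where "0 < c" "\<And>y. y \<in> S \<Longrightarrow> P y c"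
proof -
  obtain e c where e: "\<And>x. x \<in> S \<Longrightarrow> 0 < e x" and c: "\<And>x. x \<in> S \<Longrightarrow> 0 < c x"
    and P: "\<And>x y. x \<in> S \<Longrightarrow> y \<in> S \<Longrightarrow> dist x y < e x \<Longrightarrow> P y (c x)"
    using loc by metis
  obtain C where C: "C \<subseteq> S" "finite C" "S \<subseteq> (\<Union>x\<in>C. ball x (e x))"
  proof (rule compactE_image[OF S])
    show "S \<subseteq> (\<Union>x\<in>S. ball x (e x))" using e by force
  qed (auto intro: that)
  define c0 where "c0 = Min (insert 1 (c ` C))"
  have c0: "0 < c0" using C c by (auto simp: c0_def)
  show ?thesis
  proof (rule that[OF c0])
    fix y assume y: "y \<in> S"
    then obtain x where x: "x \<in> C" "dist x y < e x" using C by auto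
    then have "c0 \<le> c x" using C by (auto simp: c0_def)
    with x C y c0 show "P y c0" by (intro mono[OF P[of x y]]) auto
  qed
qed

text \<open>Near a pair of distinct points the bound holds because \<open>f\<close> separates them; near a diagonal pair
  because the derivative of a univalent function has no zeros.\<close>

lemma univalent_lower_Lipschitz:
  assumes f: "f holomorphic_on unit_disc" and inj: "inj_on f unit_disc" and r: "r < 1"
  obtains c where "0 < c"
    "\<And>a b. cmod a \<le> r \<Longrightarrow> cmod b \<le> r \<Longrightarrow> c * cmod (a - b) \<le> cmod (f a - f b)"
proof -
  let ?K = "cball 0 r \<times> cball 0 r :: (complex \<times> complex) set"
  define P where "P = (\<lambda>(a, b) c. c * cmod (a - b) \<le> cmod (f a - f b))"
  have contf: "continuous_on unit_disc f" by (rule holomorphic_on_imp_continuous_on[OF f])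
  have "\<exists>e>0. \<exists>c>0. \<forall>y\<in>?K. dist x y < e \<longrightarrow> P y c" if "x \<in> ?K" for x
  proof -
    obtain a b where x: "x = (a, b)" by (cases x)
    with that r have ab: "a \<in> unit_disc" "b \<in> unit_disc" by auto
    show ?thesis
    proof (cases "a = b")
      case False
      define m where "m = cmod (f a - f b)"
      have m: "0 < m" using False inj ab by (auto simp: m_def inj_on_def)
      have "continuous_on ?K (\<lambda>y. cmod (f (fst y) - f (snd y)))"
        using r by (intro continuous_intros continuous_on_compose2[OF contf]) auto
      with that x m obtain e where e: "0 < e"
        "\<And>y. y \<in> ?K \<Longrightarrow> dist y x < e \<Longrightarrow> dist (cmod (f (fst y) - f (snd y))) m < m / 2"
        unfolding continuous_on_iff m_def by (metis fst_conv snd_conv half_gt_zero)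
      have "P y (m / 4)" if y: "y \<in> ?K" "dist x y < e" for y
      proof -
        \<comment> \<open>Points of the disc are at distance at most \<open>2\<close>, hence the constant \<open>m/4\<close>.\<close>
        have "cmod (fst y - snd y) \<le> 2"
          using y r norm_triangle_ineq4[of "fst y" "snd y"] by auto
        then have "m / 4 * cmod (fst y - snd y) \<le> m / 4 * 2"
          using m by (intro mult_left_mono) auto
        moreover have "m / 2 < cmod (f (fst y) - f (snd y))"
          using e(2)[OF y(1)] y(2) by (simp add: dist_commute dist_real_def abs_if split: if_splits)
        ultimately show ?thesis by (simp add: P_def case_prod_beta)
      qed
      then show ?thesis using e m by (intro exI[of _ e] conjI exI[of _ "m/4"]) auto
    next
      case True
      define D where "D = deriv f a"
      \<comment> \<open>\<open>f\<close> is compared with its linear part \<open>D z\<close>, from which it differs by a small Lipschitz error.\<close>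
      have D: "D \<noteq> 0"
        unfolding D_def using holomorphic_injective_imp_regular[OF f open_ball inj] ab by blast
      have "continuous_on unit_disc (deriv f)"
        by (intro holomorphic_on_imp_continuous_on holomorphic_deriv f) auto
      then obtain e1 where e1: "0 < e1"
        "\<And>z. z \<in> unit_disc \<Longrightarrow> dist z a < e1 \<Longrightarrow> dist (deriv f z) D < cmod D / 2"
        using ab D unfolding continuous_on_iff D_def by (metis half_gt_zero zero_less_norm_iff)
      have "open unit_disc" by simp
      then obtain e2 where e2: "0 < e2" "ball a e2 \<subseteq> unit_disc"
        using ab open_contains_ball by blast
      define e where "e = min e1 e2"
      have e: "0 < e" "ball a e \<subseteq> unit_disc" using e1 e2 by (auto simp: e_def)
      have "P y (cmod D / 2)" if y: "y \<in> ?K" "dist x y < e" for y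
      proof -
        obtain p q where pq: "y = (p, q)" by (cases y)
        have near: "p \<in> ball a e" "q \<in> ball a e"
          using y(2) dist_fst_le[of x y] dist_snd_le[of x y] by (auto simp: x pq True)
        have "cmod ((f p - D * p) - (f q - D * q)) \<le> cmod D / 2 * cmod (p - q)"
        proof (rule field_differentiable_bound[of "ball a e" "\<lambda>z. f z - D * z" "\<lambda>z. deriv f z - D"])
          fix z assume z: "z \<in> ball a e"
          then have "z \<in> unit_disc" using e by blast
          then show "((\<lambda>z. f z - D * z) has_field_derivative deriv f z - D) (at z within ball a e)"
            by (auto intro!: derivative_eq_intros DERIV_subset[OF holomorphic_derivI[OF f]])
          show "cmod (deriv f z - D) \<le> cmod D / 2"
            using e1(2)[OF \<open>z \<in> unit_disc\<close>] z by (auto simp: e_def dist_commute dist_norm[symmetric])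
        qed (use near in auto)
        moreover have "D * (p - q) = (f p - f q) - ((f p - D * p) - (f q - D * q))"
          by (simp add: algebra_simps)
        ultimately have "cmod (D * (p - q)) \<le> cmod (f p - f q) + cmod D / 2 * cmod (p - q)"
          using norm_triangle_ineq4[of "f p - f q" "(f p - D * p) - (f q - D * q)"] by simp
        then show ?thesis by (simp add: P_def pq norm_mult)
      qed
      then show ?thesis using e D by (intro exI[of _ e] conjI exI[of _ "cmod D / 2"]) auto
    qed
  qed
  moreover have "P y c'" if "P y c" "0 < c'" "c' \<le> c" for y c c'
    using that mult_right_mono[of c' c "cmod (fst y - snd y)"] by (auto simp: P_def case_prod_beta)
  moreover have "compact ?K" by (intro compact_Times compact_cball)
  ultimately obtain c where "0 < c" "\<And>y. y \<in> ?K \<Longrightarrow> P y c"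
    using compact_uniform_constant[of ?K P] by blast
  then show ?thesis using that[of c] by (auto simp: P_def)
qed

text \<open>The disc of radius \<open>c\<close> is connected, meets the open set \<open>f(ball w \<rho>)\<close> in its centre, and misses
  the boundary of that set, which lies in the image of the circle.\<close>

lemma univalent_image_contains_ball:
  assumes f: "f holomorphic_on unit_disc" and inj: "inj_on f unit_disc"
    and \<rho>: "0 < \<rho>" "cball w \<rho> \<subseteq> unit_disc"
    and c: "\<And>\<zeta>. cmod (\<zeta> - w) = \<rho> \<Longrightarrow> c \<le> cmod (f \<zeta> - f w)"
  shows "ball (f w) c \<subseteq> f ` ball w \<rho>"
proof (cases "0 < c")
  case True
  have bsub: "ball w \<rho> \<subseteq> unit_disc" using \<rho> ball_subset_cball by blast
  have op: "open (f ` ball w \<rho>)"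
    using open_mapping_thm3[OF holomorphic_on_subset[OF f bsub]] inj_on_subset[OF inj bsub] by simp
  have "compact (f ` cball w \<rho>)"
    using continuous_on_subset[OF holomorphic_on_imp_continuous_on[OF f] \<rho>(2)]
    by (intro compact_continuous_image) auto
  then have "closure (f ` ball w \<rho>) \<subseteq> f ` cball w \<rho>"
    by (intro closure_minimal image_mono compact_imp_closed) auto
  then have "frontier (f ` ball w \<rho>) \<subseteq> f ` cball w \<rho> - f ` ball w \<rho>"
    using op by (auto simp: frontier_def interior_open)
  also have "\<dots> \<subseteq> f ` sphere w \<rho>" by force
  finally have fr: "frontier (f ` ball w \<rho>) \<subseteq> f ` sphere w \<rho>" .
  have "ball (f w) c \<inter> frontier (f ` ball w \<rho>) = {}"
  proof (rule ccontr)
    assume "ball (f w) c \<inter> frontier (f ` ball w \<rho>) \<noteq> {}"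
    then obtain x where "x \<in> ball (f w) c" "x \<in> f ` sphere w \<rho>" using fr by blast
    then obtain \<zeta> where "dist w \<zeta> = \<rho>" "dist (f w) (f \<zeta>) < c" by auto
    with c[of \<zeta>] show False by (simp add: dist_norm norm_minus_commute)
  qed
  moreover have "ball (f w) c \<inter> f ` ball w \<rho> \<noteq> {}" using True \<rho>(1) centre_in_ball by blast
  ultimately show ?thesis
    using connected_Int_frontier[OF connected_ball, of "f w" c "f ` ball w \<rho>"] by blast
qed (simp add: not_less ball_empty)

section \<open>From Loewner chains to evolution families\<close>

lemma decreasing_Loewner_chainD:
  assumes "decreasing_Loewner_chain d f" "0 \<le> t"
  shows "holomorphic_self_map (f t)" "inj_on (f t) unit_disc"
    and "z \<in> unit_disc \<Longrightarrow> f 0 z = z"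
    and "0 \<le> s \<Longrightarrow> s \<le> t \<Longrightarrow> f t ` unit_disc \<subseteq> f s ` unit_disc"
  using assms by (auto simp: decreasing_Loewner_chain_def simp del: mem_ball_0)

lemma chain_equicontinuous:
  assumes d: "1 \<le> d" and f: "decreasing_Loewner_chain d f"
    and T: "0 < T" and r: "r < 1" and e: "0 < e"
  obtains \<delta> where "0 < \<delta>"
    "\<And>s t z. s \<in> {0..T} \<Longrightarrow> t \<in> {0..T} \<Longrightarrow> dist s t < \<delta> \<Longrightarrow> cmod z \<le> r \<Longrightarrow> cmod (f s z - f t z) < e"
proof -
  have "compact (cball 0 r :: complex set)" "cball 0 r \<subseteq> unit_disc" using r by auto
  with f T obtain k where k: "k \<in> Lp_fun d {0..T}" and
    bound: "\<And>z s t. z \<in> cball 0 r \<Longrightarrow> 0 \<le> s \<Longrightarrow> s \<le> t \<Longrightarrow> t \<le> T \<Longrightarrow>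
      cmod (f s z - f t z) \<le> (LINT \<xi>:{s..t}|lebesgue. k \<xi>)"
    unfolding decreasing_Loewner_chain_def by meson
  obtain \<delta> where \<delta>: "0 < \<delta>" and small:
    "\<And>s t. 0 \<le> s \<Longrightarrow> s \<le> t \<Longrightarrow> t \<le> T \<Longrightarrow> t - s < \<delta> \<Longrightarrow> (LINT \<xi>:{s..t}|lebesgue. k \<xi>) < e"
    using Lp_fun_small_integrals[OF d k e] by blast
  have *: "cmod (f s z - f t z) < e"
    if "0 \<le> s" "s \<le> t" "t \<le> T" "t - s < \<delta>" "cmod z \<le> r" for s t z
    using bound[of z s t] small[of s t] that by simp
  show ?thesis
  proof (rule that[OF \<delta>])
    fix s t z assume "s \<in> {0..T}" "t \<in> {0..T}" "dist s t < \<delta>" "cmod z \<le> r"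
    then show "cmod (f s z - f t z) < e"
      using *[of s t z] *[of t s z] by (cases s t rule: linorder_le_cases)
        (auto simp: dist_real_def norm_minus_commute)
  qed
qed

text \<open>Near a given time \<open>s\<close> the lower Lipschitz constant \<open>c\<close> of \<open>f\<^sub>s\<close> survives as \<open>c/2\<close>: the difference
  \<open>f\<^sub>s - f\<^sub>t\<close> is small on a slightly larger disc, hence has Lipschitz constant at most \<open>c/2\<close>.\<close>

lemma chain_lower_Lipschitz:
  assumes d: "1 \<le> d" and f: "decreasing_Loewner_chain d f" and T: "0 < T" and r: "r < 1"
  obtains c where "0 < c"
    "\<And>s a b. s \<in> {0..T} \<Longrightarrow> cmod a \<le> r \<Longrightarrow> cmod b \<le> r \<Longrightarrow> c * cmod (a - b) \<le> cmod (f s a - f s b)"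
proof -
  define P where "P = (\<lambda>s c. \<forall>a b. cmod a \<le> r \<longrightarrow> cmod b \<le> r \<longrightarrow> c * cmod (a - b) \<le> cmod (f s a - f s b))"
  define R where "R = (1 + r) / 2"
  have R: "r < R" "R < 1" using r by (auto simp: R_def)
  have "\<exists>e>0. \<exists>c>0. \<forall>t\<in>{0..T}. dist s t < e \<longrightarrow> P t c" if s: "s \<in> {0..T}" for s
  proof -
    have hol: "f t holomorphic_on unit_disc" if "t \<in> {0..T}" for t
      using decreasing_Loewner_chainD(1)[OF f] holomorphic_self_mapD(1) that by auto
    obtain c where c: "0 < c" and lower:
      "\<And>a b. cmod a \<le> r \<Longrightarrow> cmod b \<le> r \<Longrightarrow> c * cmod (a - b) \<le> cmod (f s a - f s b)"
      using univalent_lower_Lipschitz[OF hol[OF s] decreasing_Loewner_chainD(2)[OF f] r] s by auto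
    have "0 < c / 2 * (R - r)" using c R by simp
    then obtain \<delta> where \<delta>: "0 < \<delta>" and close: "\<And>s t z. s \<in> {0..T} \<Longrightarrow> t \<in> {0..T} \<Longrightarrow>
        dist s t < \<delta> \<Longrightarrow> cmod z \<le> R \<Longrightarrow> cmod (f s z - f t z) < c / 2 * (R - r)"
      using chain_equicontinuous[OF d f T R(2)] by blast
    have "P t (c / 2)" if t: "t \<in> {0..T}" "dist s t < \<delta>" for t
      unfolding P_def
    proof (intro allI impI)
      fix a b :: complex assume ab: "cmod a \<le> r" "cmod b \<le> r"
      have "cmod ((f s a - f t a) - (f s b - f t b)) \<le> (c / 2 * (R - r)) / (R - r) * cmod (a - b)"
        by (rule holomorphic_Lipschitz_from_bound[where h = "\<lambda>z. f s z - f t z"])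
           (use R ab close[OF s t] in \<open>auto intro!: holomorphic_intros hol s t less_imp_le\<close>)
      then have "cmod ((f s a - f t a) - (f s b - f t b)) \<le> c / 2 * cmod (a - b)"
        using R by (subst (asm) nonzero_mult_div_cancel_right) auto
      moreover have "f s a - f s b = (f t a - f t b) + ((f s a - f t a) - (f s b - f t b))" by simp
      ultimately have "cmod (f s a - f s b) \<le> cmod (f t a - f t b) + c / 2 * cmod (a - b)"
        using norm_triangle_ineq[of "f t a - f t b" "(f s a - f t a) - (f s b - f t b)"] by simp
      with lower[OF ab] show "c / 2 * cmod (a - b) \<le> cmod (f t a - f t b)" by simp
    qed
    then show ?thesis using \<delta> c by (intro exI[of _ \<delta>] conjI exI[of _ "c/2"]) auto
  qed
  moreover have "P s c'" if "P s c" "0 < c'" "c' \<le> c" for s c c'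
    unfolding P_def
  proof (intro allI impI)
    fix a b :: complex assume "cmod a \<le> r" "cmod b \<le> r"
    with that(1) have "c * cmod (a - b) \<le> cmod (f s a - f s b)" by (simp add: P_def)
    with mult_right_mono[OF that(3), of "cmod (a - b)"]
    show "c' * cmod (a - b) \<le> cmod (f s a - f s b)" by simp
  qed
  ultimately obtain c where "0 < c" "\<And>s. s \<in> {0..T} \<Longrightarrow> P s c"
    using compact_uniform_constant[of "{0..T}" P] by blast
  then show ?thesis using that[of c] by (auto simp: P_def)
qed

lemma transition_maps_apply:
  "0 \<le> s \<Longrightarrow> s \<le> t \<Longrightarrow> z \<in> unit_disc \<Longrightarrow>
    transition_maps f s t z = the_inv_into unit_disc (f s) (f t z)"
  by (simp add: transition_maps_def compose_def)

lemma transition_maps_chain: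
  assumes f: "decreasing_Loewner_chain d f" and st: "0 \<le> s" "s \<le> t" and z: "z \<in> unit_disc"
  shows "transition_maps f s t z \<in> unit_disc" "f s (transition_maps f s t z) = f t z"
proof -
  have inj: "inj_on (f s) unit_disc" by (rule decreasing_Loewner_chainD(2)[OF f st(1)])
  have "f t z \<in> f s ` unit_disc" using decreasing_Loewner_chainD(4)[OF f _ st] st z by auto
  then show "transition_maps f s t z \<in> unit_disc" "f s (transition_maps f s t z) = f t z"
    unfolding transition_maps_apply[OF st z]
    using the_inv_into_into[OF inj _ subset_refl] f_the_inv_into_f[OF inj] by blast+
qed

lemma transition_maps_unique:
  assumes f: "decreasing_Loewner_chain d f" and st: "0 \<le> s" "s \<le> t"
    and z: "z \<in> unit_disc" and v: "v \<in> unit_disc" "f s v = f t z"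
  shows "transition_maps f s t z = v"
  using transition_maps_chain[OF f st z] inj_onD[OF decreasing_Loewner_chainD(2)[OF f st(1)]] v by metis

lemma transition_maps_self_map:
  assumes f: "decreasing_Loewner_chain d f" and st: "0 \<le> s" "s \<le> t"
  shows "holomorphic_self_map (transition_maps f s t)"
proof -
  have t: "0 \<le> t" using st by simp
  note inj = decreasing_Loewner_chainD(2)[OF f st(1)]
  obtain g where g: "g holomorphic_on f s ` unit_disc" and inv: "\<And>z. z \<in> unit_disc \<Longrightarrow> g (f s z) = z"
    using holomorphic_has_inverse[OF holomorphic_self_mapD(1)[OF decreasing_Loewner_chainD(1)[OF f st(1)]]
      open_ball inj] by metis
  have "(g \<circ> f t) holomorphic_on unit_disc"
    using holomorphic_on_compose_gen[OF holomorphic_self_mapD(1)[OF decreasing_Loewner_chainD(1)[OF f t]] g]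
      decreasing_Loewner_chainD(4)[OF f t st] by blast
  moreover have "(g \<circ> f t) z = transition_maps f s t z" if "z \<in> unit_disc" for z
    using inv[OF transition_maps_chain(1)[OF f st that]] transition_maps_chain(2)[OF f st that] by simp
  ultimately have "transition_maps f s t holomorphic_on unit_disc"
    using holomorphic_transform by blast
  then show ?thesis
    using transition_maps_chain(1)[OF f st] by (auto simp: holomorphic_self_map_def simp del: mem_ball_0)
qed

text \<open>Let \<open>w = \<phi>\<^sub>s\<^sub>0\<^sub>,\<^sub>u\<^sub>0(z)\<close>. For \<open>(s,u)\<close> near \<open>(s\<^sub>0,u\<^sub>0)\<close> the point \<open>f\<^sub>u(z)\<close> is close to \<open>f\<^sub>s(w)\<close>,
  hence is taken by \<open>f\<^sub>s\<close> near \<open>w\<close>; as \<open>f\<^sub>s\<close> is injective, the point where it is taken is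
  \<open>\<phi>\<^sub>s\<^sub>,\<^sub>u(z)\<close>.\<close>

lemma transition_orbit_compact:
  assumes d: "1 \<le> d" and f: "decreasing_Loewner_chain d f" and T: "0 < T" and z: "z \<in> unit_disc"
  obtains r where "r < 1"
    "\<And>s u. 0 \<le> s \<Longrightarrow> s \<le> u \<Longrightarrow> u \<le> T \<Longrightarrow> cmod (transition_maps f s u z) \<le> r"
proof -
  define \<phi> where "\<phi> = transition_maps f"
  define P where "P = (\<lambda>p c. cmod (\<phi> (fst p) (snd p) z) \<le> 1 - c)"
  define S where "S = ({0..T} \<times> {0..T}) \<inter> {p :: real \<times> real. fst p \<le> snd p}"
  have "closed {p :: real \<times> real. fst p \<le> snd p}"
    by (intro closed_Collect_le continuous_intros)
  then have "compact S"
    unfolding S_def by (intro compact_Int_closed compact_Times) auto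
  moreover have "\<exists>e>0. \<exists>c>0. \<forall>p\<in>S. dist p0 p < e \<longrightarrow> P p c" if p0: "p0 \<in> S" for p0
  proof -
    obtain s0 u0 where su0: "p0 = (s0, u0)" by (cases p0)
    with p0 have in0: "0 \<le> s0" "s0 \<le> u0" "u0 \<le> T" by (auto simp: S_def)
    define w where "w = \<phi> s0 u0 z"
    have w: "cmod w < 1" and fw: "f s0 w = f u0 z"
      using transition_maps_chain[OF f in0(1,2) z] by (auto simp: w_def \<phi>_def)
    define \<rho> where "\<rho> = (1 - cmod w) / 2"
    have \<rho>: "0 < \<rho>" "cmod w + \<rho> = 1 - \<rho>" using w by (auto simp: \<rho>_def field_simps)
    have sub: "cmod v \<le> cmod w + dist w v" for v
      by (metis dist_norm norm_minus_commute norm_triangle_sub)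
    have r0: "cmod w + \<rho> < 1" using \<rho> by simp
    obtain c where c: "0 < c" and lower: "\<And>s a b. s \<in> {0..T} \<Longrightarrow> cmod a \<le> cmod w + \<rho> \<Longrightarrow>
        cmod b \<le> cmod w + \<rho> \<Longrightarrow> c * cmod (a - b) \<le> cmod (f s a - f s b)"
      using chain_lower_Lipschitz[OF d f T r0] by blast
    have "0 < c * \<rho> / 2" using c \<rho> by simp
    moreover have "max (cmod w) (cmod z) < 1" using w z by simp
    ultimately obtain \<delta> where \<delta>: "0 < \<delta>" and close: "\<And>s t v. s \<in> {0..T} \<Longrightarrow> t \<in> {0..T} \<Longrightarrow>
        dist s t < \<delta> \<Longrightarrow> cmod v \<le> max (cmod w) (cmod z) \<Longrightarrow> cmod (f s v - f t v) < c * \<rho> / 2"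
      using chain_equicontinuous[OF d f T] by blast
    have "P p \<rho>" if p: "p \<in> S" "dist p0 p < \<delta>" for p
    proof -
      obtain s u where su: "p = (s, u)" by (cases p)
      with p have in1: "0 \<le> s" "s \<le> u" "u \<le> T" by (auto simp: S_def)
      have near: "dist s0 s < \<delta>" "dist u0 u < \<delta>"
        using p(2) dist_fst_le[of p0 p] dist_snd_le[of p0 p] by (auto simp: su0 su)
      have "cmod (f s0 w - f s w) < c * \<rho> / 2" "cmod (f u0 z - f u z) < c * \<rho> / 2"
        using in0 in1 near close[of s0 s w] close[of u0 u z] by auto
      moreover have "f s w - f u z = (f u0 z - f u z) - (f s0 w - f s w)" by (simp add: fw)
      ultimately have "f u z \<in> ball (f s w) (c * \<rho>)"
        using norm_triangle_ineq4[of "f u0 z - f u z" "f s0 w - f s w"] by (simp add: dist_norm)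
      also have "ball (f s w) (c * \<rho>) \<subseteq> f s ` ball w \<rho>"
      proof (rule univalent_image_contains_ball)
        show "f s holomorphic_on unit_disc" "inj_on (f s) unit_disc"
          using decreasing_Loewner_chainD[OF f in1(1)] holomorphic_self_mapD(1) by auto
        show "cball w \<rho> \<subseteq> unit_disc"
        proof
          fix v assume "v \<in> cball w \<rho>"
          then show "v \<in> unit_disc" using sub[of v] \<rho> by simp
        qed
        fix \<zeta> assume \<zeta>: "cmod (\<zeta> - w) = \<rho>"
        then have "cmod \<zeta> \<le> cmod w + \<rho>" using sub[of \<zeta>] by (simp add: dist_norm norm_minus_commute)
        with lower[of s \<zeta> w] \<zeta> \<rho> in1 show "c * \<rho> \<le> cmod (f s \<zeta> - f s w)" by simp
      qed (rule \<rho>)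
      finally obtain v where v: "v \<in> ball w \<rho>" "f s v = f u z" by auto
      then have le: "cmod v \<le> 1 - \<rho>" using sub[of v] \<rho> by simp
      moreover have "\<phi> s u z = v"
        unfolding \<phi>_def using le \<rho> v by (intro transition_maps_unique[OF f in1(1,2) z]) auto
      ultimately show ?thesis by (simp add: P_def su)
    qed
    then show ?thesis using \<delta> \<rho> by blast
  qed
  moreover have "P p c'" if "P p c" "0 < c'" "c' \<le> c" for p c c'
    using that by (simp add: P_def)
  ultimately obtain c where c: "0 < c" "\<And>p. p \<in> S \<Longrightarrow> P p c"
    using compact_uniform_constant[of S P] by blast
  show ?thesis
  proof (rule that[of "1 - c"])
    fix s u :: real assume "0 \<le> s" "s \<le> u" "u \<le> T"
    then show "cmod (transition_maps f s u z) \<le> 1 - c"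
      using c(2)[of "(s, u)"] by (simp add: P_def S_def \<phi>_def)
  qed (use c in simp)
qed

lemma chain_imp_reverse_evolution_family:
  assumes d: "1 \<le> d" and f: "decreasing_Loewner_chain d f"
  shows "reverse_evolution_family d (transition_maps f)"
  unfolding reverse_evolution_family_def
proof (intro conjI allI ballI impI)
  fix s t :: real assume "0 \<le> s \<and> s \<le> t"
  then show "holomorphic_self_map (transition_maps f s t)"
    by (intro transition_maps_self_map[OF f]) auto
next
  fix s z assume "(0::real) \<le> s" "z \<in> unit_disc"
  then show "transition_maps f s s z = z" by (intro transition_maps_unique[OF f]) auto
next
  fix s u t :: real and z assume "0 \<le> s \<and> s \<le> u \<and> u \<le> t" and z: "z \<in> unit_disc"
  then have *: "0 \<le> s" "s \<le> u" "0 \<le> u" "u \<le> t" "s \<le> t" by auto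
  show "transition_maps f s t z = transition_maps f s u (transition_maps f u t z)"
    using transition_maps_chain[OF f *(3,4) z]
      transition_maps_chain[OF f *(1,2) transition_maps_chain(1)[OF f *(3,4) z]]
    by (intro transition_maps_unique[OF f *(1,5) z]) auto
next
  fix z T assume z: "z \<in> unit_disc" and T: "(0::real) < T"
  have "compact {z}" "{z} \<subseteq> unit_disc" using z by auto
  with f T obtain k where k: "k \<in> Lp_fun d {0..T}" "\<forall>\<xi>\<in>{0..T}. 0 \<le> k \<xi>" and
    bound: "\<And>s t. 0 \<le> s \<Longrightarrow> s \<le> t \<Longrightarrow> t \<le> T \<Longrightarrow> cmod (f s z - f t z) \<le> (LINT \<xi>:{s..t}|lebesgue. k \<xi>)"
    unfolding decreasing_Loewner_chain_def by (metis singletonI)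
  obtain r where r: "r < 1" "\<And>s u. 0 \<le> s \<Longrightarrow> s \<le> u \<Longrightarrow> u \<le> T \<Longrightarrow> cmod (transition_maps f s u z) \<le> r"
    using transition_orbit_compact[OF d f T z] by blast
  obtain c where c: "0 < c" and lower: "\<And>s a b. s \<in> {0..T} \<Longrightarrow> cmod a \<le> r \<Longrightarrow> cmod b \<le> r \<Longrightarrow>
      c * cmod (a - b) \<le> cmod (f s a - f s b)"
    using chain_lower_Lipschitz[OF d f T r(1)] by blast
  show "\<exists>k\<in>Lp_fun d {0..T}. (\<forall>\<xi>\<in>{0..T}. 0 \<le> k \<xi>) \<and>
      (\<forall>s u t. 0 \<le> s \<and> s \<le> u \<and> u \<le> t \<and> t \<le> T \<longrightarrow>
        cmod (transition_maps f s u z - transition_maps f s t z) \<le> (LINT \<xi>:{u..t}|lebesgue. k \<xi>))"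
  proof (intro bexI[of _ "\<lambda>\<xi>. 1 / c * k \<xi>"] conjI allI impI)
    show "(\<lambda>\<xi>. 1 / c * k \<xi>) \<in> Lp_fun d {0..T}" by (rule Lp_fun_cmult[OF k(1)])
    show "\<forall>\<xi>\<in>{0..T}. 0 \<le> 1 / c * k \<xi>" using k(2) c by simp
    fix s u t assume "0 \<le> s \<and> s \<le> u \<and> u \<le> t \<and> t \<le> T"
    then have *: "0 \<le> s" "s \<le> u" "u \<le> t" "t \<le> T" "s \<le> t" "u \<le> T" "0 \<le> u" by auto
    have "c * cmod (transition_maps f s u z - transition_maps f s t z) \<le> cmod (f u z - f t z)"
      using lower[of s "transition_maps f s u z" "transition_maps f s t z"] r(2)[of s u] r(2)[of s t] *
        transition_maps_chain(2)[OF f *(1,2) z] transition_maps_chain(2)[OF f *(1,5) z] by simp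
    also have "\<dots> \<le> (LINT \<xi>:{u..t}|lebesgue. k \<xi>)" using * by (intro bound)
    finally show "cmod (transition_maps f s u z - transition_maps f s t z)
        \<le> (LINT \<xi>:{u..t}|lebesgue. 1 / c * k \<xi>)"
      using c by (simp add: field_simps)
  qed
qed

section \<open>From evolution families to Loewner chains\<close>

lemma reverse_evolution_familyD:
  assumes "reverse_evolution_family d \<phi>" "0 \<le> s"
  shows "s \<le> t \<Longrightarrow> holomorphic_self_map (\<phi> s t)"
    and "z \<in> unit_disc \<Longrightarrow> \<phi> s s z = z"
    and "s \<le> u \<Longrightarrow> u \<le> t \<Longrightarrow> z \<in> unit_disc \<Longrightarrow> \<phi> s t z = \<phi> s u (\<phi> u t z)"
  using assms by (auto simp: reverse_evolution_family_def simp del: mem_ball_0)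

lemma family_kernel:
  assumes \<phi>: "reverse_evolution_family d \<phi>" and T: "0 < T" and z: "z \<in> unit_disc"
  obtains k where "k \<in> Lp_fun d {0..T}" "\<And>\<xi>. \<xi> \<in> {0..T} \<Longrightarrow> 0 \<le> k \<xi>"
    "\<And>s t. 0 \<le> s \<Longrightarrow> s \<le> t \<Longrightarrow> t \<le> T \<Longrightarrow> cmod (z - \<phi> s t z) \<le> (LINT \<xi>:{s..t}|lebesgue. k \<xi>)"
proof -
  from \<phi> T z obtain k where k: "k \<in> Lp_fun d {0..T}" "\<forall>\<xi>\<in>{0..T}. 0 \<le> k \<xi>" and
    bound: "\<And>s u t. 0 \<le> s \<Longrightarrow> s \<le> u \<Longrightarrow> u \<le> t \<Longrightarrow> t \<le> T \<Longrightarrow>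
      cmod (\<phi> s u z - \<phi> s t z) \<le> (LINT \<xi>:{u..t}|lebesgue. k \<xi>)"
    unfolding reverse_evolution_family_def by meson
  show ?thesis
  proof (rule that[OF k(1)])
    show "0 \<le> k \<xi>" if "\<xi> \<in> {0..T}" for \<xi> using k(2) that by blast
    fix s t assume st: "0 \<le> s" "s \<le> t" "t \<le> T"
    then show "cmod (z - \<phi> s t z) \<le> (LINT \<xi>:{s..t}|lebesgue. k \<xi>)"
      using bound[OF st(1) order_refl st(2,3)] reverse_evolution_familyD(2)[OF \<phi> st(1) z] by simp
  qed
qed

text \<open>The rigidity of self-maps reduces the uncountably many kernels of a family, one for each point, to
  those of the two points \<open>0\<close> and \<open>1/2\<close>.\<close>

lemma family_displacement:
  assumes d: "1 \<le> d" and \<phi>: "reverse_evolution_family d \<phi>" and T: "0 < T" and r: "r < 1"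
  obtains k where "k \<in> Lp_fun d {0..T}" "\<And>\<xi>. \<xi> \<in> {0..T} \<Longrightarrow> 0 \<le> k \<xi>"
    "\<And>s t z. 0 \<le> s \<Longrightarrow> s \<le> t \<Longrightarrow> t \<le> T \<Longrightarrow> cmod z \<le> r \<Longrightarrow>
      cmod (z - \<phi> s t z) \<le> (LINT \<xi>:{s..t}|lebesgue. k \<xi>)"
proof -
  obtain k where k: "k \<in> Lp_fun d {0..T}" "\<And>\<xi>. \<xi> \<in> {0..T} \<Longrightarrow> 0 \<le> k \<xi>"
    "\<And>s t. 0 \<le> s \<Longrightarrow> s \<le> t \<Longrightarrow> t \<le> T \<Longrightarrow> cmod (0 - \<phi> s t 0) \<le> (LINT \<xi>:{s..t}|lebesgue. k \<xi>)"
    by (rule family_kernel[OF \<phi> T, of 0]) auto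
  obtain l where l: "l \<in> Lp_fun d {0..T}" "\<And>\<xi>. \<xi> \<in> {0..T} \<Longrightarrow> 0 \<le> l \<xi>"
    "\<And>s t. 0 \<le> s \<Longrightarrow> s \<le> t \<Longrightarrow> t \<le> T \<Longrightarrow> cmod (1/2 - \<phi> s t (1/2)) \<le> (LINT \<xi>:{s..t}|lebesgue. l \<xi>)"
    by (rule family_kernel[OF \<phi> T, of "1/2"]) auto
  \<comment> \<open>The maximum is needed for negative \<open>r\<close> only, where the disc is empty.\<close>
  have "0 \<le> max r 0" "max r 0 < 1" using r by auto
  then obtain C where C: "0 < C" and disp: "\<And>g z. holomorphic_self_map g \<Longrightarrow> cmod z \<le> max r 0 \<Longrightarrow>
      cmod (z - g z) \<le> C * (cmod (0 - g 0) + cmod (1/2 - g (1/2)))"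
    using self_map_displacement by blast
  show ?thesis
  proof (rule that[of "\<lambda>\<xi>. C * (k \<xi> + l \<xi>)"])
    show "(\<lambda>\<xi>. C * (k \<xi> + l \<xi>)) \<in> Lp_fun d {0..T}"
      by (intro Lp_fun_cmult Lp_fun_add k l)
    show "0 \<le> C * (k \<xi> + l \<xi>)" if "\<xi> \<in> {0..T}" for \<xi>
      using k(2)[OF that] l(2)[OF that] C by simp
    fix s t z assume st: "0 \<le> s" "s \<le> t" "t \<le> T" and z: "cmod z \<le> r"
    have "cmod (z - \<phi> s t z) \<le> C * (cmod (0 - \<phi> s t 0) + cmod (1/2 - \<phi> s t (1/2)))"
      using z by (intro disp reverse_evolution_familyD(1)[OF \<phi>] st) auto
    also have "\<dots> \<le> C * ((LINT \<xi>:{s..t}|lebesgue. k \<xi>) + (LINT \<xi>:{s..t}|lebesgue. l \<xi>))"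
      using C by (intro mult_left_mono add_mono k(3) l(3) st) auto
    also have "\<dots> = (LINT \<xi>:{s..t}|lebesgue. C * (k \<xi> + l \<xi>))"
      using Lp_fun_set_integrable[OF d k(1) st(1,3)] Lp_fun_set_integrable[OF d l(1) st(1,3)]
      by (simp add: set_integral_add)
    finally show "cmod (z - \<phi> s t z) \<le> (LINT \<xi>:{s..t}|lebesgue. C * (k \<xi> + l \<xi>))" .
  qed
qed

lemma family_near_identity:
  assumes d: "1 \<le> d" and \<phi>: "reverse_evolution_family d \<phi>" and T: "0 < T" and r: "r < 1" and e: "0 < e"
  obtains \<delta> where "0 < \<delta>"
    "\<And>s t z. 0 \<le> s \<Longrightarrow> s \<le> t \<Longrightarrow> t \<le> T \<Longrightarrow> t - s < \<delta> \<Longrightarrow> cmod z \<le> r \<Longrightarrow> cmod (z - \<phi> s t z) < e"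
proof -
  obtain k where k: "k \<in> Lp_fun d {0..T}" and "\<And>\<xi>. \<xi> \<in> {0..T} \<Longrightarrow> 0 \<le> k \<xi>" and bound:
    "\<And>s t z. 0 \<le> s \<Longrightarrow> s \<le> t \<Longrightarrow> t \<le> T \<Longrightarrow> cmod z \<le> r \<Longrightarrow>
      cmod (z - \<phi> s t z) \<le> (LINT \<xi>:{s..t}|lebesgue. k \<xi>)"
    by (rule family_displacement[OF d \<phi> T r]) auto
  obtain \<delta> where \<delta>: "0 < \<delta>" and small:
    "\<And>s t. 0 \<le> s \<Longrightarrow> s \<le> t \<Longrightarrow> t \<le> T \<Longrightarrow> t - s < \<delta> \<Longrightarrow> (LINT \<xi>:{s..t}|lebesgue. k \<xi>) < e"
    by (rule Lp_fun_small_integrals[OF d k e]) auto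
  show ?thesis
  proof (rule that[OF \<delta>])
    fix s t z assume st: "0 \<le> s" "s \<le> t" "t \<le> T" "t - s < \<delta>" "cmod z \<le> r"
    from bound[OF st(1-3,5)] small[OF st(1-4)] show "cmod (z - \<phi> s t z) < e"
      by (rule le_less_trans)
  qed
qed

text \<open>Induction down from \<open>t\<close> in short steps. Half of \<open>\<delta>\<close> is used for the length of a step so that the
  closed condition on \<open>n\<close> implies the strict bound \<open>u - s < \<delta>\<close>. The number of steps is passed to
  \<open>Q\<close> because bounds may degrade with each step.\<close>

lemma backward_subdivision_induct:
  fixes \<delta> t :: real
  assumes \<delta>: "0 < \<delta>" and base: "Q 0 t"
    and step: "\<And>n s u. 0 \<le> s \<Longrightarrow> s \<le> u \<Longrightarrow> u \<le> t \<Longrightarrow> u - s < \<delta> \<Longrightarrow> Q n u \<Longrightarrow> Q (Suc n) s"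
    and s: "0 \<le> s" "s \<le> t" and n: "t - s \<le> real n * (\<delta> / 2)"
  shows "Q n s"
  using s n
proof (induction n arbitrary: s)
  case 0
  then have "s = t" by simp
  with base show ?case by simp
next
  case (Suc n)
  define u where "u = min t (s + \<delta> / 2)"
  have u: "s \<le> u" "u \<le> t" "u - s < \<delta>" "t - u \<le> real n * (\<delta> / 2)" "0 \<le> u"
    using Suc.prems \<delta> by (auto simp: u_def min_def algebra_simps)
  show ?case
    by (rule step[OF Suc.prems(1) u(1-3) Suc.IH[OF u(5,2,4)]])
qed

lemma enough_half_steps:
  fixes \<delta> :: real
  assumes "0 < \<delta>"
  obtains n where "x \<le> real n * (\<delta> / 2)"
  using ex_less_of_nat_mult[of "\<delta> / 2" x] assms by (auto intro: less_imp_le)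

text \<open>A short step sends \<open>0\<close> into the disc of radius \<open>1/2\<close>, so it multiplies the distance of a point to
  the unit circle by at least \<open>1/4\<close>. The number of steps needed to cover \<open>[0,T]\<close> does not
  depend on the point.\<close>

lemma family_locally_bounded:
  assumes d: "1 \<le> d" and \<phi>: "reverse_evolution_family d \<phi>" and T: "0 < T" and r: "r < 1"
  obtains R where "R < 1"
    "\<And>s t z. 0 \<le> s \<Longrightarrow> s \<le> t \<Longrightarrow> t \<le> T \<Longrightarrow> cmod z \<le> r \<Longrightarrow> cmod (\<phi> s t z) \<le> R"
proof -
  obtain \<delta> where \<delta>: "0 < \<delta>" and near: "\<And>s t z. 0 \<le> s \<Longrightarrow> s \<le> t \<Longrightarrow> t \<le> T \<Longrightarrow> t - s < \<delta> \<Longrightarrow>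
      cmod z \<le> 0 \<Longrightarrow> cmod (z - \<phi> s t z) < 1 / 2"
    by (rule family_near_identity[OF d \<phi> T, of 0 "1/2"]) auto
  obtain n where n: "T \<le> real n * (\<delta> / 2)" by (rule enough_half_steps[OF \<delta>])
  show ?thesis
  proof (rule that[of "1 - (1/4) ^ n * (1 - r)"])
    show "1 - (1/4) ^ n * (1 - r) < 1" using r by simp
  next
    fix s t z assume st: "0 \<le> s" "s \<le> t" "t \<le> T" and z: "cmod z \<le> r"
    have z1: "z \<in> unit_disc" using z r by simp
    have "(1/4) ^ n * (1 - cmod z) \<le> 1 - cmod (\<phi> s t z)"
    proof (rule backward_subdivision_induct[where Q = "\<lambda>n s. (1/4) ^ n * (1 - cmod z) \<le> 1 - cmod (\<phi> s t z)"
          and n = n and t = t, OF \<delta> _ _ st(1,2)])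
      show "(1/4) ^ 0 * (1 - cmod z) \<le> 1 - cmod (\<phi> t t z)"
        using reverse_evolution_familyD(2)[OF \<phi> _ z1, of t] st by simp
      show "t - s \<le> real n * (\<delta> / 2)" using n st by simp
    next
      fix m s u assume su: "0 \<le> s" "s \<le> u" "u \<le> t" "u - s < \<delta>"
        and IH: "(1/4) ^ m * (1 - cmod z) \<le> 1 - cmod (\<phi> u t z)"
      have w: "\<phi> u t z \<in> unit_disc"
        using holomorphic_self_mapD(2)[OF reverse_evolution_familyD(1)[OF \<phi>] z1] su by simp
      have "cmod (0 - \<phi> s u 0) < 1 / 2" using su st by (intro near) auto
      then have half: "1 / 2 \<le> 1 - cmod (\<phi> s u 0)" by simp
      have "(1/4) ^ Suc m * (1 - cmod z) \<le> 1 / 2 * (1 - cmod (\<phi> u t z)) / 2"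
        using IH by simp
      also have "\<dots> \<le> (1 - cmod (\<phi> s u 0)) * (1 - cmod (\<phi> u t z)) / 2"
        using half w by (intro divide_right_mono mult_right_mono) auto
      also have "\<dots> \<le> 1 - cmod (\<phi> s u (\<phi> u t z))"
        by (rule self_map_boundary_distance[OF reverse_evolution_familyD(1)[OF \<phi> su(1,2)] w])
      finally show "(1/4) ^ Suc m * (1 - cmod z) \<le> 1 - cmod (\<phi> s t z)"
        using reverse_evolution_familyD(3)[OF \<phi> su(1-3) z1] by simp
    qed
    moreover have "(1/4) ^ n * (1 - r) \<le> (1/4) ^ n * (1 - cmod z)"
      using z by (intro mult_left_mono) auto
    ultimately show "cmod (\<phi> s t z) \<le> 1 - (1/4) ^ n * (1 - r)" by linarith
  qed
qed

text \<open>If \<open>g(a) = g(b)\<close>, then \<open>a - b\<close> is the difference of the values at \<open>a\<close> and \<open>b\<close> of \<open>z - g(z)\<close>, a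
  function with Lipschitz constant at most \<open>1/2\<close>.\<close>

lemma near_identity_injective:
  assumes g: "holomorphic_self_map g" and R: "R < 1" "r < R"
    and near: "\<And>z. cmod z \<le> R \<Longrightarrow> cmod (z - g z) \<le> (R - r) / 2"
    and ab: "cmod a \<le> r" "cmod b \<le> r" and eq: "g a = g b"
  shows "a = b"
proof -
  have "cmod ((a - g a) - (b - g b)) \<le> ((R - r) / 2) / (R - r) * cmod (a - b)"
    by (rule holomorphic_Lipschitz_from_bound[where h = "\<lambda>z. z - g z", OF _ R near ab])
       (auto intro!: holomorphic_intros holomorphic_self_mapD(1)[OF g])
  also have "((R - r) / 2) / (R - r) = 1 / 2" using R by simp
  finally show ?thesis using eq by simp
qed

text \<open>If \<open>\<phi>\<^sub>s\<^sub>,\<^sub>t(a) = \<phi>\<^sub>s\<^sub>,\<^sub>t(b)\<close>, cancel the short steps one by one from the left: each is injective on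
  the compact set that contains both orbits. After the last of them \<open>\<phi>\<^sub>t\<^sub>,\<^sub>t = id\<close> remains.\<close>

lemma family_univalent:
  assumes d: "1 \<le> d" and \<phi>: "reverse_evolution_family d \<phi>" and st: "0 \<le> s" "s \<le> t"
  shows "inj_on (\<phi> s t) unit_disc"
proof (rule inj_onI)
  fix a b assume a: "a \<in> unit_disc" and b: "b \<in> unit_disc" and eq: "\<phi> s t a = \<phi> s t b"
  define T where "T = t + 1"
  have T: "0 < T" "t \<le> T" using st by (auto simp: T_def)
  define r where "r = max (cmod a) (cmod b)"
  have "r < 1" using a b by (simp add: r_def)
  then obtain r' where r': "r' < 1" and bdd:
    "\<And>s t z. 0 \<le> s \<Longrightarrow> s \<le> t \<Longrightarrow> t \<le> T \<Longrightarrow> cmod z \<le> r \<Longrightarrow> cmod (\<phi> s t z) \<le> r'"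
    by (rule family_locally_bounded[OF d \<phi> T(1)]) auto
  \<comment> \<open>Orbits stay in the disc of radius \<open>r'\<close>; the larger radius \<open>R\<close> leaves room for Cauchy's estimate.\<close>
  define R where "R = (1 + r') / 2"
  have R: "R < 1" "r' < R" using r' by (auto simp: R_def)
  then have e: "0 < (R - r') / 2" by simp
  obtain \<delta> where \<delta>: "0 < \<delta>" and near: "\<And>s t z. 0 \<le> s \<Longrightarrow> s \<le> t \<Longrightarrow> t \<le> T \<Longrightarrow> t - s < \<delta> \<Longrightarrow>
      cmod z \<le> R \<Longrightarrow> cmod (z - \<phi> s t z) < (R - r') / 2"
    by (rule family_near_identity[OF d \<phi> T(1) R(1) e]) auto
  obtain n where n: "t - s \<le> real n * (\<delta> / 2)" by (rule enough_half_steps[OF \<delta>])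
  have "\<phi> s t a = \<phi> s t b \<longrightarrow> a = b"
  proof (rule backward_subdivision_induct[where Q = "\<lambda>_ u. \<phi> u t a = \<phi> u t b \<longrightarrow> a = b"
        and n = n, OF \<delta> _ _ st n])
    show "\<phi> t t a = \<phi> t t b \<longrightarrow> a = b"
      using reverse_evolution_familyD(2)[OF \<phi> order_trans[OF st]] a b by simp
  next
    fix s u assume su: "0 \<le> s" "s \<le> u" "u \<le> t" "u - s < \<delta>"
      and IH: "\<phi> u t a = \<phi> u t b \<longrightarrow> a = b"
    show "\<phi> s t a = \<phi> s t b \<longrightarrow> a = b"
    proof
      assume "\<phi> s t a = \<phi> s t b"
      then have "\<phi> s u (\<phi> u t a) = \<phi> s u (\<phi> u t b)"
        using reverse_evolution_familyD(3)[OF \<phi> su(1-3)] a b by metis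
      moreover have "cmod (\<phi> u t a) \<le> r'" "cmod (\<phi> u t b) \<le> r'"
        using su T by (simp_all add: bdd r_def)
      moreover have "cmod (z - \<phi> s u z) \<le> (R - r') / 2" if "cmod z \<le> R" for z
        using near[OF su(1,2) _ su(4) that] su(3) T(2) by simp
      ultimately have "\<phi> u t a = \<phi> u t b"
        using near_identity_injective[OF reverse_evolution_familyD(1)[OF \<phi> su(1,2)] R] by blast
      with IH show "a = b" by simp
    qed
  qed
  with eq show "a = b" by simp
qed

text \<open>For the \<open>L\<^sup>d\<close> estimate, \<open>\<phi>\<^sub>0\<^sub>,\<^sub>s(z) - \<phi>\<^sub>0\<^sub>,\<^sub>t(z)\<close> is the difference of the values of \<open>\<phi>\<^sub>0\<^sub>,\<^sub>s\<close> at \<open>z\<close>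
  and at \<open>\<phi>\<^sub>s\<^sub>,\<^sub>t(z)\<close>, both of which stay in a fixed smaller disc, where all self-maps share a
  Lipschitz constant.\<close>

lemma reverse_evolution_family_imp_chain:
  assumes d: "1 \<le> d" and \<phi>: "reverse_evolution_family d \<phi>"
  shows "decreasing_Loewner_chain d (\<lambda>t. \<phi> 0 t)"
  unfolding decreasing_Loewner_chain_def
proof (intro conjI allI impI)
  fix t :: real assume "0 \<le> t"
  then show "holomorphic_self_map (\<phi> 0 t)" "inj_on (\<phi> 0 t) unit_disc"
    by (auto intro: reverse_evolution_familyD(1)[OF \<phi>] family_univalent[OF d \<phi>])
next
  show "\<forall>z\<in>unit_disc. \<phi> 0 0 z = z" using reverse_evolution_familyD(2)[OF \<phi>] by auto
next
  fix s t :: real assume "0 \<le> s \<and> s \<le> t"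
  then have st: "0 \<le> s" "s \<le> t" by auto
  show "\<phi> 0 t ` unit_disc \<subseteq> \<phi> 0 s ` unit_disc"
  proof (rule image_subsetI)
    fix z assume z: "z \<in> unit_disc"
    show "\<phi> 0 t z \<in> \<phi> 0 s ` unit_disc"
      using reverse_evolution_familyD(3)[OF \<phi> order_refl st z]
        holomorphic_self_mapD(2)[OF reverse_evolution_familyD(1)[OF \<phi> st] z] by blast
  qed
next
  fix K :: "complex set" and T :: real
  assume "compact K \<and> K \<subseteq> unit_disc \<and> 0 < T"
  then have K: "compact K" "K \<subseteq> unit_disc" and T: "0 < T" by auto
  obtain r where r: "r < 1" "\<And>z. z \<in> K \<Longrightarrow> cmod z \<le> r"
  proof (cases "K = {}")
    case False
    then obtain w where "w \<in> K" "\<And>z. z \<in> K \<Longrightarrow> cmod z \<le> cmod w"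
      using continuous_attains_sup[OF K(1), of cmod] continuous_on_norm_id by blast
    with K that show ?thesis by auto
  qed (use that[of 0] in auto)
  obtain R where R: "R < 1" and bdd:
    "\<And>s t z. 0 \<le> s \<Longrightarrow> s \<le> t \<Longrightarrow> t \<le> T \<Longrightarrow> cmod z \<le> r \<Longrightarrow> cmod (\<phi> s t z) \<le> R"
    by (rule family_locally_bounded[OF d \<phi> T r(1)]) auto
  define \<rho> where "\<rho> = max r R"
  have \<rho>: "\<rho> < 1" using r R by (simp add: \<rho>_def)
  obtain k where k: "k \<in> Lp_fun d {0..T}" "\<And>\<xi>. \<xi> \<in> {0..T} \<Longrightarrow> 0 \<le> k \<xi>" and disp:
    "\<And>s t z. 0 \<le> s \<Longrightarrow> s \<le> t \<Longrightarrow> t \<le> T \<Longrightarrow> cmod z \<le> r \<Longrightarrow>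
      cmod (z - \<phi> s t z) \<le> (LINT \<xi>:{s..t}|lebesgue. k \<xi>)"
    by (rule family_displacement[OF d \<phi> T r(1)]) auto
  define L where "L = 2 / (1 - \<rho>)"
  have L: "0 \<le> L" using \<rho> by (simp add: L_def)
  show "\<exists>k\<in>Lp_fun d {0..T}. (\<forall>\<xi>\<in>{0..T}. 0 \<le> k \<xi>) \<and> (\<forall>z\<in>K. \<forall>s t. 0 \<le> s \<and> s \<le> t \<and> t \<le> T \<longrightarrow>
      cmod (\<phi> 0 s z - \<phi> 0 t z) \<le> (LINT \<xi>:{s..t}|lebesgue. k \<xi>))"
  proof (intro bexI[of _ "\<lambda>\<xi>. L * k \<xi>"] conjI ballI allI impI)
    show "(\<lambda>\<xi>. L * k \<xi>) \<in> Lp_fun d {0..T}" by (rule Lp_fun_cmult[OF k(1)])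
    show "0 \<le> L * k \<xi>" if "\<xi> \<in> {0..T}" for \<xi> using k(2)[OF that] L by simp
    fix z s t assume z: "z \<in> K" and "0 \<le> s \<and> s \<le> t \<and> t \<le> T"
    then have st: "0 \<le> s" "s \<le> t" "t \<le> T" by auto
    have z1: "z \<in> unit_disc" using z K by blast
    have "cmod (\<phi> 0 s z - \<phi> 0 t z) = cmod (\<phi> 0 s z - \<phi> 0 s (\<phi> s t z))"
      using reverse_evolution_familyD(3)[OF \<phi> order_refl st(1,2) z1] by simp
    also have "\<dots> \<le> L * cmod (z - \<phi> s t z)"
      unfolding L_def using r(2)[OF z] bdd[OF st r(2)[OF z]]
      by (intro self_map_Lipschitz[OF reverse_evolution_familyD(1)[OF \<phi> order_refl st(1)] \<rho>])
         (auto simp: \<rho>_def)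
    also have "\<dots> \<le> L * (LINT \<xi>:{s..t}|lebesgue. k \<xi>)"
      by (intro mult_left_mono disp st r(2) z L)
    finally show "cmod (\<phi> 0 s z - \<phi> 0 t z) \<le> (LINT \<xi>:{s..t}|lebesgue. L * k \<xi>)" by simp
  qed
qed

lemma family_eq_inverse:
  assumes d: "1 \<le> d" and \<phi>: "reverse_evolution_family d \<phi>"
    and st: "0 \<le> s" "s \<le> t" and z: "z \<in> unit_disc"
  shows "\<phi> s t z = the_inv_into unit_disc (\<phi> 0 s) (\<phi> 0 t z)"
  using the_inv_into_f_f[OF family_univalent[OF d \<phi> order_refl st(1)]
      holomorphic_self_mapD(2)[OF reverse_evolution_familyD(1)[OF \<phi> st] z]]
    reverse_evolution_familyD(3)[OF \<phi> order_refl st z] by simp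

section \<open>The correspondence\<close>

text \<open>The inverse correspondence is \<open>\<phi> \<mapsto> \<phi>\<^sub>0\<^sub>,\<^sub>\<cdot>\<close>. Off their domains both composites reproduce the default
  value, because the representatives are extensional.\<close>

lemma transition_maps_bij:
  assumes d: "1 \<le> d"
  shows "bij_betw transition_maps (decreasing_Loewner_chains d) (reverse_evolution_families d)"
proof (rule bij_betw_byWitness[where f' = "\<lambda>\<phi>. \<phi> 0"])
  show "\<forall>f\<in>decreasing_Loewner_chains d. transition_maps f 0 = f"
  proof (intro ballI ext)
    fix f t z assume "f \<in> decreasing_Loewner_chains d"
    then have f: "decreasing_Loewner_chain d f" "\<And>t. 0 \<le> t \<Longrightarrow> f t \<in> extensional unit_disc"
      "\<And>t. \<not> 0 \<le> t \<Longrightarrow> f t = undefined" by (auto simp: decreasing_Loewner_chains_def)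
    show "transition_maps f 0 t z = f t z"
    proof (cases "0 \<le> t \<and> z \<in> unit_disc")
      case True
      then have t: "0 \<le> t" and z: "z \<in> unit_disc" by auto
      have "f t z \<in> unit_disc"
        by (rule holomorphic_self_mapD(2)[OF decreasing_Loewner_chainD(1)[OF f(1) t] z])
      then show ?thesis
        using decreasing_Loewner_chainD(3)[OF f(1) order_refl]
        by (intro transition_maps_unique[OF f(1) order_refl t z]) auto
    next
      case False
      then show ?thesis
        using f(2,3) by (auto simp: transition_maps_def compose_def extensional_def)
    qed
  qed
  show "\<forall>\<phi>\<in>reverse_evolution_families d. transition_maps (\<phi> 0) = \<phi>"
  proof (intro ballI ext)
    fix \<phi> s t z assume "\<phi> \<in> reverse_evolution_families d"
    then have \<phi>: "reverse_evolution_family d \<phi>"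
      "\<And>s t. 0 \<le> s \<Longrightarrow> s \<le> t \<Longrightarrow> \<phi> s t \<in> extensional unit_disc"
      "\<And>s t. \<not> (0 \<le> s \<and> s \<le> t) \<Longrightarrow> \<phi> s t = undefined"
      unfolding reverse_evolution_families_def by blast+
    show "transition_maps (\<phi> 0) s t z = \<phi> s t z"
    proof (cases "0 \<le> s \<and> s \<le> t")
      case True
      then show ?thesis
        using family_eq_inverse[OF d \<phi>(1), of s t z] \<phi>(2)[of s t]
        by (cases "z \<in> unit_disc") (auto simp: transition_maps_def compose_def extensional_def)
    next
      case False
      with \<phi>(3)[OF False] show ?thesis by (auto simp: transition_maps_def)
    qed
  qed
  show "transition_maps ` decreasing_Loewner_chains d \<subseteq> reverse_evolution_families d"
    using chain_imp_reverse_evolution_family[OF d]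
    by (auto simp: decreasing_Loewner_chains_def reverse_evolution_families_def transition_maps_def)
  show "(\<lambda>\<phi>. \<phi> 0) ` reverse_evolution_families d \<subseteq> decreasing_Loewner_chains d"
    using reverse_evolution_family_imp_chain[OF d]
    by (auto simp: decreasing_Loewner_chains_def reverse_evolution_families_def)
qed

theorem theorem4p1:
  fixes d :: ennreal
  assumes "1 \<le> d"
  shows "bij_betw transition_maps (decreasing_Loewner_chains d) (reverse_evolution_families d)
    \<and> (\<forall>f. decreasing_Loewner_chain d f \<longrightarrow> reverse_evolution_family d (transition_maps f))
    \<and> (\<forall>\<phi>. reverse_evolution_family d \<phi> \<longrightarrow>
          decreasing_Loewner_chain d (\<lambda>t. \<phi> 0 t) \<and>
          (\<forall>s t. 0 \<le> s \<and> s \<le> t \<longrightarrow>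
            (\<forall>z\<in>unit_disc. \<phi> s t z = the_inv_into unit_disc (\<phi> 0 s) (\<phi> 0 t z))))"
  using transition_maps_bij[OF assms] chain_imp_reverse_evolution_family[OF assms]
    reverse_evolution_family_imp_chain[OF assms] family_eq_inverse[OF assms] by blast

end
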